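(* For any integer $J\ge1$, the function $(\nu,\mu)\mapsto G_{\nu/\mu}(v,qv,\dots,q^{J-1}v)$ of two signatures $\nu,\mu$ of the same length corresponds to the vertex weights given by $$\widetilde w_v^{(J)}(i_1,j_1;i_2,j_2)=\frac{(-1)^{i_1+j_1}q^{\frac{i_1^2+i_2^2}{4}+\frac{i_1(j_1-1)+i_2j_2}{2}}s^{j_1-i_1}v^{i_1}(vs^{-1};q)_{j_1-i_2}}{(q;q)_{i_1}(vs;q)_{i_1+j_1}}\ {}_4\bar\phi_3\left(\begin{matrix}q^{-i_1};\,q^{-i_2},\,q^Jsv,\,qsv^{-1}\\ s^2,\,q^{1+j_1-i_2},\,q^{1+J-i_1-j_1}\end{matrix}\,\Big|\,q,q\right)$$ if $i_1+j_1=i_2+j_2$, and by $0$ otherwise ($i_1,j_1,i_2,j_2\in\mathbb{Z}_{\ge0}$).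
   Context: Throughout, $q,s$ are fixed generic complex parameters and $v$ is a generic complex number (no denominator vanishes); fractional powers of $q$ are taken with respect to a fixed choice of $q^{1/4}$. Pochhammer symbols: $(x;q)_n=\prod_{r=0}^{n-1}(1-xq^r)$ for $n>0$, $(x;q)_0=1$, and $(x;q)_n=\big((1-q^nx)(1-q^{n+1}x)\cdots(1-q^{-1}x)\big)^{-1}$ for $n<0$. Regularized terminating basic hypergeometric series, for integer $n\ge 0$: $${}_{r+1}\bar\phi_r\left(\begin{matrix}q^{-n};a_1,\dots,a_r\\ b_1,\dots,b_r\end{matrix}\,\Big|\,q,z\right)=\sum_{k=0}^nz^k\frac{(q^{-n};q)_k}{(q;q)_k}\prod_{i=1}^r(a_i;q)_k\,(b_iq^k;q)_{n-k}.$$ Signatures: a signature of length $L$ is a string of integers $\lambda=(\lambda_1\ge\dots\ge\lambda_L)$; $\mathrm{Sign}_L$ is the set of all of them. Vertex weights: for $u\in\mathbb{C}$ and integers $m\ge 0$, $w_u(m,0;m,0)=\frac{1-sq^mu}{1-su}$, $w_u(m,1;m,1)=\frac{u-sq^m}{1-su}$, $w_u(m+1,0;m,1)=\frac{(1-s^2q^m)u}{1-su}$, $w_u(m,1;m+1,0)=\frac{1-q^{m+1}}{1-su}$, and $w_u(i_1,j_1;i_2,j_2)=0$ for all other nonnegative integers. Path weights: in the square grid, assign to each vertex $(i,j)$ the variable $u_j$ (constant along rows). A vertex is interior to an up-right path if it lies on the path and is not its beginning or ending vertex. The weight of a finite collection of up-right paths is the product, over all vertices interior to the paths of the collection, of $w_{u_j}(i_1,j_1;i_2,j_2)$,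 where $i_1,j_1,i_2,j_2$ are the numbers of paths of the collection containing the South, West, North, East edge at the vertex (weight $1$ if there are no interior vertices). Two collections are identified if they have the same interior vertices and the same numbers $(i_1,j_1,i_2,j_2)$ at each of them. $G$: for $L,k\ge0$, $\nu,\mu\in\mathrm{Sign}_L$, $G_{\nu/\mu}(u_1,\dots,u_k)$ is the sum of weights of all collections of $L$ up-right paths that start with the vertical edges $(\mu_n,0)\to(\mu_n,1)$, $1\le n\le L$, and end with the vertical edges $(\nu_l,k)\to(\nu_l,k+1)$, $1\le l\le L$. Correspondence: a function $H(\nu,\mu)$ of two signatures of the same length $L$ corresponds to vertex weights $\{w^{(H)}(i_1,j_1;i_2,j_2)\}_{i_1,j_1,i_2,j_2\ge0}$ if each value $H(\nu,\mu)$ equals the sum, over all collections (two collections being identified if they have the same interior vertices and the same numbers $(i_1,j_1,i_2,j_2)$ at each of them) of $L$ up-right paths that start with the vertical edges $(\mu_n,0)\to(\mu_n,1)$ and end with the vertical edges $(\nu_l,1)\to(\nu_l,2)$ (a single horizontal row of vertices), of the product over interior vertices of the weights $w^{(H)}(i_1,j_1;i_2,j_2)$, where $i_1,j_1,i_2,j_2$ count the paths through the South, West, North, East edges of the vertex. Horizontal edges may be used by several paths. *)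

theory Defs
  imports Complex_Main "HOL-Library.Multiset"
begin

definition qpoch :: "complex \<Rightarrow> complex \<Rightarrow> int \<Rightarrow> complex" where
  "qpoch x q n =
     (if n \<ge> 0 then (\<Prod>r\<in>{0..<n}. 1 - x * q powi r)
      else inverse (\<Prod>r\<in>{n..<0}. 1 - q powi r * x))"

(* The terminating series with first upper parameter q^(-n), the remaining upper parameters
   "as" and the lower parameters "bs"; meant for lists of equal length r. *)
definition phi_bar ::
    "nat \<Rightarrow> complex list \<Rightarrow> complex list \<Rightarrow> complex \<Rightarrow> complex \<Rightarrow> complex" where
  "phi_bar n as bs q z =
     (\<Sum>k=0..n. z ^ k * (qpoch (q powi (- int n)) q (int k) / qpoch q q (int k)) *
        (\<Prod>i<length as. qpoch (as ! i) q (int k) *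
                        qpoch ((bs ! i) * q ^ k) q (int (n - k))))"

definition Sign :: "nat \<Rightarrow> int list set" where
  "Sign L = {xs. length xs = L \<and> sorted_wrt (\<ge>) xs}"

definition vertex_weight ::
    "complex \<Rightarrow> complex \<Rightarrow> complex \<Rightarrow> nat \<Rightarrow> nat \<Rightarrow> nat \<Rightarrow> nat \<Rightarrow> complex" where
  "vertex_weight q s u i1 j1 i2 j2 =
     (if j1 = 0 \<and> j2 = 0 \<and> i2 = i1 then (1 - s * q ^ i1 * u) / (1 - s * u)
      else if j1 = 1 \<and> j2 = 1 \<and> i2 = i1 then (u - s * q ^ i1) / (1 - s * u)
      else if j1 = 0 \<and> j2 = 1 \<and> i1 = i2 + 1 then (1 - s\<^sup>2 * q ^ i2) * u / (1 - s * u)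
      else if j1 = 1 \<and> j2 = 0 \<and> i2 = i1 + 1 then (1 - q ^ (i1 + 1)) / (1 - s * u)
      else 0)"

type_synonym vertex = "int \<times> int"

(* A path is the list of its successive vertices. *)
definition up_right_path :: "vertex list \<Rightarrow> bool" where
  "up_right_path P \<longleftrightarrow> P \<noteq> [] \<and>
     successively (\<lambda>x y. y = (fst x + 1, snd x) \<or> y = (fst x, snd x + 1)) P"

definition path_edges :: "vertex list \<Rightarrow> (vertex \<times> vertex) set" where
  "path_edges P = set (zip P (tl P))"

definition first_edge :: "vertex list \<Rightarrow> vertex \<times> vertex" where
  "first_edge P = (P ! 0, P ! 1)"

definition last_edge :: "vertex list \<Rightarrow> vertex \<times> vertex" where
  "last_edge P = (P ! (length P - 2), P ! (length P - 1))"

definition path_interior :: "vertex list \<Rightarrow> vertex set" where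
  "path_interior P = set P - {hd P, last P}"

(* Collections of paths are multisets, as several paths may coincide.  Which starting edge is
   joined to which final edge is not prescribed, so the edges are compared as multisets. *)
definition collections :: "nat \<Rightarrow> int list \<Rightarrow> int list \<Rightarrow> vertex list multiset set" where
  "collections k \<nu> \<mu> =
     {C. (\<forall>P\<in>#C. up_right_path P \<and> length P \<ge> 2) \<and>
         image_mset first_edge C = mset (map (\<lambda>m. ((m, 0), (m, 1))) \<mu>) \<and>
         image_mset last_edge C = mset (map (\<lambda>l. ((l, int k), (l, int k + 1))) \<nu>)}"

definition edge_count :: "vertex list multiset \<Rightarrow> vertex \<times> vertex \<Rightarrow> nat" where
  "edge_count C e = size {#P \<in># C. e \<in> path_edges P#}"

fun vertex_state :: "vertex list multiset \<Rightarrow> vertex \<Rightarrow> nat \<times> nat \<times> nat \<times> nat" where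
  "vertex_state C (i, j) =
     (edge_count C ((i, j - 1), (i, j)),
      edge_count C ((i - 1, j), (i, j)),
      edge_count C ((i, j), (i, j + 1)),
      edge_count C ((i, j), (i + 1, j)))"

definition collection_interior :: "vertex list multiset \<Rightarrow> vertex set" where
  "collection_interior C = (\<Union>P\<in>set_mset C. path_interior P)"

(* The interior vertices of a collection together with the path counts at each of them:
   two collections are identified iff they have the same configuration. *)
definition configuration ::
    "vertex list multiset \<Rightarrow> (vertex \<times> nat \<times> nat \<times> nat \<times> nat) set" where
  "configuration C = (\<lambda>x. (x, vertex_state C x)) ` collection_interior C"

(* "W j" are the vertex weights used in row j.  Both index sets are finite, since the paths have
   prescribed first and last edges. *)
definition path_sum ::
    "(int \<Rightarrow> nat \<Rightarrow> nat \<Rightarrow> nat \<Rightarrow> nat \<Rightarrow> complex) \<Rightarrow> nat \<Rightarrow> int list \<Rightarrow> int list \<Rightarrow> complex"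
  where
  "path_sum W k \<nu> \<mu> =
     (\<Sum>c \<in> configuration ` collections k \<nu> \<mu>.
        \<Prod>((i, j), (i1, j1, i2, j2)) \<in> c. W j i1 j1 i2 j2)"

(* The variables u_1, ..., u_k of the rows 1, ..., k are given as a list "us". *)
definition G ::
    "complex \<Rightarrow> complex \<Rightarrow> complex list \<Rightarrow> int list \<Rightarrow> int list \<Rightarrow> complex" where
  "G q s us \<nu> \<mu> = path_sum (\<lambda>j. vertex_weight q s (us ! nat (j - 1))) (length us) \<nu> \<mu>"

definition corresponds ::
    "(int list \<Rightarrow> int list \<Rightarrow> complex) \<Rightarrow> (nat \<Rightarrow> nat \<Rightarrow> nat \<Rightarrow> nat \<Rightarrow> complex) \<Rightarrow> bool" where
  "corresponds H w \<longleftrightarrow>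
     (\<forall>L. \<forall>\<nu>\<in>Sign L. \<forall>\<mu>\<in>Sign L. H \<nu> \<mu> = path_sum (\<lambda>_. w) 1 \<nu> \<mu>)"

(* Here q4 is the chosen fourth root q^(1/4); the exponent of q4 is four times the exponent
   (i1^2 + i2^2)/4 + (i1 (j1 - 1) + i2 j2)/2 of q. *)
definition fused_weight ::
    "complex \<Rightarrow> complex \<Rightarrow> complex \<Rightarrow> nat \<Rightarrow> complex \<Rightarrow>
     nat \<Rightarrow> nat \<Rightarrow> nat \<Rightarrow> nat \<Rightarrow> complex" where
  "fused_weight q4 q s J v i1 j1 i2 j2 =
     (if i1 + j1 = i2 + j2 then
        (-1) ^ (i1 + j1)
        * q4 powi ((int i1)\<^sup>2 + (int i2)\<^sup>2 + 2 * (int i1 * (int j1 - 1) + int i2 * int j2))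
        * s powi (int j1 - int i1) * v ^ i1
        * qpoch (v * inverse s) q (int j1 - int i2)
        / (qpoch q q (int i1) * qpoch (v * s) q (int i1 + int j1))
        * phi_bar i1
            [q powi (- int i2), q ^ J * s * v, q * s * inverse v]
            [s\<^sup>2, q powi (1 + int j1 - int i2), q powi (1 + int J - int i1 - int j1)]
            q q
      else 0)"

end

(* A collection of paths in a strip of rows is determined, as far as its weight goes, by the
   multisets M_0, ..., M_k of abscissae at which the paths cross from one row to the next; the
   number of paths on a horizontal edge of row r is the difference of the counting functions of
   M_(r-1) and M_r.  Hence a single row carries exactly one configuration (or none), and G for J + 1
   rows is the sum over M_J of G for J rows times the weight of the top row.

   By induction on J it suffices to fuse a row carrying the weight with parameter J with a row of
   ordinary vertices with variable q^J v.  The sum over the intermediate multiset is a sum, over the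
   columns, of the number b in {0, 1} of paths on the edge of the top row, and is evaluated column
   by column: if the j paths leaving a column are split as (j - b, b) with relative weights
   p_b(j), then so are the paths leaving the next one, and the fused weight factors out.  This
   amounts to two identities between three fused weights, one for each value of b.
   For b = 0 it is a contiguous relation that holds term by term, for b = 1 it uses that the series
   is balanced and follows by telescoping.  The induction starts at J = 0, where the weight is the
   identity. *)
theory Submission
  imports Defs
begin

section \<open>Counting functions of multisets and the weight of a single row\<close>

section \<open>Sums over the rows of vertices\<close>

text \<open>Vertex weights have a gauge freedom: a factor \<open>g j1 / g j2\<close> cancels along a
  row, since no path enters or leaves a row horizontally. This is where the unfamiliar
  \<open>split1\<close> comes from. With \<open>g j = (-s)^(-j) q4^(-j^2) (q;q)_j\<close>, the
  quantities \<open>split0 J j\<close> and \<open>split1 J j * g j / g (j - 1)\<close> are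
  \<open>1 - q^(J+1-j)\<close> and \<open>q^(J+1-j) (1 - q^j)\<close>, with sum
  \<open>1 - q^(J+1)\<close>. These are the odds of an empty or an occupied top row when the sets of
  \<open>j\<close> rows among \<open>0, ..., J\<close> are weighted by \<open>q\<close> to the sum
  of the row indices; the geometric progression of the row variables makes every column preserve
  this distribution.

  Two degenerations shape the argument. First, \<open>split0 J j\<close> is 0 at
  \<open>j = J + 1\<close>, so the column recursion is arranged to divide by \<open>p 0 0\<close>
  only. Second, the lower parameters \<open>q^(1+j1-i2)\<close> and \<open>q^(1+J-i1-j1)\<close> are
  powers of \<open>q\<close>, whose Pochhammer symbols may vanish. The contiguous relations are
  therefore proved directly for the regularized series, where these symbols are numerators, and hold
  at the boundary states without any limit.\<close>

definition below :: "int multiset \<Rightarrow> int \<Rightarrow> nat" where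
  "below M x = size {#y \<in># M. y \<le> x#}"

text \<open>Number of paths on the edge from column \<open>x\<close> to column \<open>x + 1\<close>.
  Under \<open>dominates M N\<close> the truncated subtraction is the true difference.\<close>

definition flux :: "int multiset \<Rightarrow> int multiset \<Rightarrow> int \<Rightarrow> nat" where
  "flux M N x = below M x - below N x"

definition dominates :: "int multiset \<Rightarrow> int multiset \<Rightarrow> bool" where
  "dominates M N \<longleftrightarrow> size M = size N \<and> (\<forall>x. below N x \<le> below M x)"

text \<open>By conservation a vertex is visited iff some path enters it from below or from the left,
  which gives the index set. Without dominance no paths lead from \<open>M\<close> to
  \<open>N\<close>.\<close>

definition row_sum :: "(nat \<Rightarrow> nat \<Rightarrow> nat \<Rightarrow> nat \<Rightarrow> complex) \<Rightarrow> int multiset \<Rightarrow> int multiset \<Rightarrow> complex" where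
  "row_sum w M N =
     (if dominates M N
      then \<Prod>x | count M x + flux M N (x - 1) > 0.
             w (count M x) (flux M N (x - 1)) (count N x) (flux M N x)
      else 0)"

lemma below_union: "below (M + N) x = below M x + below N x"
  by (simp add: below_def)

lemma below_rec: "below M x = below M (x - 1) + count M x"
proof (induction M)
  case (add y M)
  then show ?case by (auto simp: below_def)
qed (simp add: below_def)

lemma below_le_size: "below M x \<le> size M"
  by (simp add: below_def size_filter_mset_lesseq)

lemma below_eq_0:
  assumes "set_mset M \<subseteq> {a..b}" "x < a"
  shows "below M x = 0"
proof -
  have "{#y \<in># M. y \<le> x#} = {#}" using assms by (auto simp: multiset_eq_iff not_in_iff[symmetric])
  then show ?thesis by (simp add: below_def)
qed

lemma below_eq_size:
  assumes "set_mset M \<subseteq> {a..b}" "b \<le> x"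
  shows "below M x = size M"
proof -
  have "{#y \<in># M. y \<le> x#} = M" using assms by (auto simp: filter_mset_eq_conv)
  then show ?thesis by (simp add: below_def)
qed

lemma dominates_refl: "dominates M M"
  by (simp add: dominates_def)

lemma dominates_trans: "dominates M K \<Longrightarrow> dominates K N \<Longrightarrow> dominates M N"
  by (auto simp: dominates_def intro: order_trans)

lemma flux_conserve:
  assumes "dominates M N"
  shows "count M x + flux M N (x - 1) = count N x + flux M N x"
proof -
  have "below N x \<le> below M x" "below N (x - 1) \<le> below M (x - 1)"
    using assms by (auto simp: dominates_def)
  then show ?thesis
    unfolding flux_def using below_rec[of M x] below_rec[of N x] by linarith
qed

lemma flux_eq_0:
  assumes "dominates M N" "set_mset M \<subseteq> {a..b}" "set_mset N \<subseteq> {a..b}" "x < a \<or> b \<le> x"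
  shows "flux M N x = 0"
  using assms below_eq_0[of M a b x] below_eq_size[of M a b x] below_eq_size[of N a b x]
  by (auto simp: flux_def dominates_def)

lemma row_support_subset:
  assumes "dominates M N" "set_mset M \<subseteq> {a..b}" "set_mset N \<subseteq> {a..b}"
  shows "{x. count M x + flux M N (x - 1) > 0} \<subseteq> {a..b}"
proof (rule subsetI, rule ccontr)
  fix x assume x: "x \<in> {x. count M x + flux M N (x - 1) > 0}" and out: "x \<notin> {a..b}"
  have "count M x = 0" using out assms(2) by (meson not_in_iff subset_iff)
  moreover have "flux M N (x - 1) = 0" using out by (intro flux_eq_0[OF assms]) auto
  ultimately show False using x by (simp add: count_eq_zero_iff)
qed

text \<open>The unvisited columns contribute \<open>w 0 0 0 0 = 1\<close>. Extending the product to
  a fixed interval lets rows with different supports be multiplied column by column.\<close>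

lemma row_sum_interval:
  assumes w: "w 0 0 0 0 = 1" and dom: "dominates M N"
    and sub: "set_mset M \<subseteq> {a..b}" "set_mset N \<subseteq> {a..b}"
  shows "row_sum w M N = (\<Prod>x\<in>{a..b}. w (count M x) (flux M N (x - 1)) (count N x) (flux M N x))"
  unfolding row_sum_def if_P[OF dom]
proof (rule prod.mono_neutral_left)
  show "\<forall>x\<in>{a..b} - {x. 0 < count M x + flux M N (x - 1)}.
     w (count M x) (flux M N (x - 1)) (count N x) (flux M N x) = 1"
  proof
    fix x assume "x \<in> {a..b} - {x. 0 < count M x + flux M N (x - 1)}"
    then have "count M x + flux M N (x - 1) = 0" by (simp add: count_eq_zero_iff)
    with flux_conserve[OF dom, of x] w show "w (count M x) (flux M N (x - 1)) (count N x) (flux M N x) = 1"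
      by simp
  qed
qed (use row_support_subset[OF dom sub] in auto)

lemma mset_bounds:
  obtains a b :: int where "a \<le> b" "set_mset M \<subseteq> {a..b}" "set_mset N \<subseteq> {a..b}"
proof -
  let ?S = "insert 0 (set_mset M \<union> set_mset N)"
  have "Min ?S \<le> 0" "0 \<le> Max ?S" by simp_all
  then have "Min ?S \<le> Max ?S" by (rule order_trans)
  moreover have "set_mset M \<subseteq> {Min ?S..Max ?S}" "set_mset N \<subseteq> {Min ?S..Max ?S}"
    by auto
  ultimately show ?thesis by (rule that)
qed

text \<open>No path can be to the left of all of \<open>M\<close> or to the right of all of
  \<open>N\<close>, so the sum over the intermediate multiset is finite.\<close>

lemma dominates_between_bounds:
  assumes "dominates M K" "dominates K N" "set_mset M \<subseteq> {a..b}" "set_mset N \<subseteq> {a..b}"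
  shows "set_mset K \<subseteq> {a..b}"
proof
  fix x assume x: "x \<in># K"
  then have cx: "count K x > 0" by simp
  have "a \<le> x"
  proof (rule ccontr)
    assume "\<not> a \<le> x"
    then have "below M x = 0" using assms by (intro below_eq_0) auto
    then have "below K x = 0" using assms by (metis dominates_def le_zero_eq)
    then show False using below_rec[of K x] cx by simp
  qed
  moreover have "x \<le> b"
  proof (rule ccontr)
    assume "\<not> x \<le> b"
    then have "below N (x - 1) = size N" using assms by (intro below_eq_size) auto
    then have "size N \<le> below K (x - 1)" using assms by (metis dominates_def)
    moreover have "size K = size N" using assms by (simp add: dominates_def)
    ultimately show False
      using below_rec[of K x] cx below_le_size[of K x] by linarith
  qed
  ultimately show "x \<in> {a..b}" by simp
qed

lemma finite_msets_of_size: "finite A \<Longrightarrow> finite {K. size K = n \<and> set_mset K \<subseteq> A}"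
proof -
  assume A: "finite A"
  have "{K. size K = n \<and> set_mset K \<subseteq> A} \<subseteq> mset ` {xs. set xs \<subseteq> A \<and> length xs = n}"
  proof
    fix K :: "'a multiset" assume K: "K \<in> {K. size K = n \<and> set_mset K \<subseteq> A}"
    obtain xs where "mset xs = K" using ex_mset by blast
    with K show "K \<in> mset ` {xs. set xs \<subseteq> A \<and> length xs = n}" by auto
  qed
  then show ?thesis by (rule finite_surj[OF finite_lists_length_eq[OF A]])
qed

lemma finite_dominates_between: "finite {K. dominates M K \<and> dominates K N}"
proof -
  obtain a b where ab: "set_mset M \<subseteq> {a..b}" "set_mset N \<subseteq> {a..b}" using mset_bounds by metis
  have "{K. dominates M K \<and> dominates K N} \<subseteq> {K. size K = size M \<and> set_mset K \<subseteq> {a..b}}"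
  proof
    fix K assume "K \<in> {K. dominates M K \<and> dominates K N}"
    with dominates_between_bounds[OF _ _ ab] show "K \<in> {K. size K = size M \<and> set_mset K \<subseteq> {a..b}}"
      by (simp add: dominates_def)
  qed
  then show ?thesis by (rule finite_subset) (simp add: finite_msets_of_size)
qed

section \<open>Fusing two adjacent rows column by column\<close>

lemma below_shift_by_set:
  assumes "finite B" and bal: "\<And>x. count K x + of_bool (x - 1 \<in> B) = count N x + of_bool (x \<in> B)"
  shows "below K x = below N x + of_bool (x \<in> B)" and "size K = size N"
proof -
  let ?I = "image_mset (\<lambda>x. x + 1) (mset_set B)"
  have I: "?I = mset_set ((\<lambda>x. x + 1) ` B)" by (rule image_mset_mset_set) simp
  have mem: "x \<in> (\<lambda>x. x + 1) ` B \<longleftrightarrow> x - 1 \<in> B" for x by force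
  \<comment> \<open>A form without subtraction of the fact that \<open>K\<close> arises from
    \<open>N\<close> by moving one point from \<open>x + 1\<close> to \<open>x\<close> for each
    \<open>x\<close> in \<open>B\<close>. Counting the points up to \<open>x\<close> on both sides
    gives the indicator of \<open>B\<close>.\<close>
  have eq: "K + ?I = N + mset_set B"
  proof (rule multiset_eqI)
    fix x
    show "count (K + ?I) x = count (N + mset_set B) x"
      using bal[of x] \<open>finite B\<close> unfolding I by (auto simp: count_mset_set' mem)
  qed
  then have "size K + card B = size N + card B"
    by (metis size_union size_image_mset size_mset_set)
  then show "size K = size N" by simp
  have "below ?I x = below (mset_set B) (x - 1)"
    unfolding below_def filter_mset_image_mset by (simp add: algebra_simps)
  moreover have "below (mset_set B) x = below (mset_set B) (x - 1) + of_bool (x \<in> B)"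
    using below_rec[of "mset_set B" x] \<open>finite B\<close> by (simp add: count_mset_set')
  ultimately show "below K x = below N x + of_bool (x \<in> B)"
    using arg_cong[OF eq, of "\<lambda>K. below K x"] by (simp add: below_union)
qed

lemma sum_Pow_insert:
  assumes "finite A" "a \<notin> A"
  shows "(\<Sum>B\<in>Pow (insert a A). f B) = (\<Sum>B\<in>Pow A. f B) + (\<Sum>B\<in>Pow A. f (insert a B))"
proof -
  have "(\<Sum>B\<in>Pow (insert a A). f B) = (\<Sum>B\<in>Pow A. f B) + (\<Sum>B\<in>insert a ` Pow A. f B)"
    unfolding Pow_insert using assms by (intro sum.union_disjoint) auto
  also have "(\<Sum>B\<in>insert a ` Pow A. f B) = (\<Sum>B\<in>Pow A. f (insert a B))"
    using assms by (subst sum.reindex) (auto simp: inj_on_def)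
  finally show ?thesis .
qed

(* B is the set of columns with a path on the horizontal edge of the top row, H the total flux through
   both rows.  The sum is over the configurations to the left of y, with b' paths leaving column y. *)
lemma column_sum:
  fixes G :: "int \<Rightarrow> nat \<Rightarrow> nat \<Rightarrow> complex" and p W :: "_ \<Rightarrow> _" and H :: "int \<Rightarrow> nat"
  assumes H0: "H (a - 1) = 0" and p00: "p 0 0 \<noteq> (0::complex)"
    and G0: "\<And>x \<beta> \<beta>'. \<beta> > H (x - 1) \<Longrightarrow> G x \<beta> \<beta>' = 0"
    and rec: "\<And>x \<beta>'. \<beta>' \<le> 1 \<Longrightarrow> \<beta>' \<le> H x \<Longrightarrow>
       p \<beta>' (H x) * W x = (\<Sum>\<beta>\<in>{0, 1}. p \<beta> (H (x - 1)) * G x \<beta> \<beta>')"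
    and y: "a - 1 \<le> y"
    and \<beta>': "\<beta>' \<le> 1" "\<beta>' \<le> H y"
  shows "(\<Sum>B\<in>Pow {a - 1..<y}. \<Prod>x\<in>{a..y}.
       G x (of_bool (x - 1 \<in> B \<union> (if \<beta>' = 1 then {y} else {}))) (of_bool (x \<in> B \<union> (if \<beta>' = 1 then {y} else {}))))
     = p \<beta>' (H y) / p 0 0 * (\<Prod>x\<in>{a..y}. W x)"
  using y \<beta>'
proof (induction y arbitrary: \<beta>' rule: int_ge_induct)
  \<comment> \<open>The columns start at \<open>a - 1\<close> rather than \<open>a\<close>, so that
    here the only \<open>B\<close> is empty and every later step inserts exactly one column. A path
    leaving column \<open>a - 1\<close> is ruled out by \<open>G0\<close>, since
    \<open>H (a - 1) = 0\<close>.\<close>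
  case base
  then show ?case using H0 p00 by simp
next
  case (step y)
  define E where "E = (if \<beta>' = 1 then {y + 1} else {})"
  define A where "A = {a - 1..<y}"
  define P where "P B = (\<Prod>x\<in>{a..y}. G x (of_bool (x - 1 \<in> B)) (of_bool (x \<in> B)))" for B
  have ivl: "{a - 1..<y + 1} = insert y A" "{a..y + 1} = insert (y + 1) {a..y}"
    using step.hyps by (auto simp: A_def)
  have yA: "y \<notin> A" "finite A" by (auto simp: A_def)
  have \<beta>E: "of_bool (y + 1 \<in> E) = \<beta>'" using step.prems by (auto simp: E_def)
  have split: "(\<Prod>x\<in>{a..y + 1}. G x (of_bool (x - 1 \<in> B \<union> E)) (of_bool (x \<in> B \<union> E)))
     = P B * G (y + 1) (of_bool (y \<in> B)) \<beta>'" if "B \<subseteq> insert y A" for B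
  proof -
    have *: "y + 1 \<notin> B" using that by (auto simp: A_def)
    have "y \<notin> E" by (simp add: E_def)
    moreover have "(\<Prod>x\<in>{a..y}. G x (of_bool (x - 1 \<in> B \<union> E)) (of_bool (x \<in> B \<union> E))) = P B"
      unfolding P_def by (rule prod.cong) (auto simp: E_def)
    ultimately show ?thesis
      using \<beta>E * unfolding ivl by (simp add: mult.commute)
  qed
  have "(\<Sum>B\<in>Pow {a - 1..<y + 1}. \<Prod>x\<in>{a..y + 1}. G x (of_bool (x - 1 \<in> B \<union> E)) (of_bool (x \<in> B \<union> E)))
     = (\<Sum>B\<in>Pow (insert y A). P B * G (y + 1) (of_bool (y \<in> B)) \<beta>')"
    unfolding ivl(1) by (intro sum.cong refl split) auto
  also have "\<dots> = (\<Sum>B\<in>Pow A. P B * G (y + 1) 0 \<beta>') + (\<Sum>B\<in>Pow A. P (insert y B) * G (y + 1) 1 \<beta>')"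
    using yA by (subst sum_Pow_insert) (auto intro!: arg_cong2[of _ _ _ _ "(+)"] sum.cong)
  also have "\<dots> = (\<Sum>\<beta>\<in>{0, 1}. (\<Sum>B\<in>Pow A. P (B \<union> (if \<beta> = 1 then {y} else {}))) * G (y + 1) \<beta> \<beta>')"
    by (simp add: sum_distrib_right)
  also have "\<dots> = (\<Sum>\<beta>\<in>{0, 1}. p \<beta> (H y) / p 0 0 * (\<Prod>x\<in>{a..y}. W x) * G (y + 1) \<beta> \<beta>')"
  proof (intro sum.cong refl)
    fix \<beta> :: nat assume \<beta>: "\<beta> \<in> {0, 1}"
    show "(\<Sum>B\<in>Pow A. P (B \<union> (if \<beta> = 1 then {y} else {}))) * G (y + 1) \<beta> \<beta>'
       = p \<beta> (H y) / p 0 0 * (\<Prod>x\<in>{a..y}. W x) * G (y + 1) \<beta> \<beta>'"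
    proof (cases "\<beta> \<le> H y")
      case True
      then show ?thesis using step.IH[of \<beta>] \<beta> by (auto simp: P_def A_def)
    next
      \<comment> \<open>The top row would carry more paths than both rows together; the induction
        hypothesis says nothing here, but the next column kills the term.\<close>
      case False
      then show ?thesis using G0[of "y + 1" \<beta> \<beta>'] by simp
    qed
  qed
  also have "\<dots> = (\<Prod>x\<in>{a..y}. W x) / p 0 0 * (\<Sum>\<beta>\<in>{0, 1}. p \<beta> (H (y + 1 - 1)) * G (y + 1) \<beta> \<beta>')"
    by (simp add: algebra_simps)
  also have "\<dots> = p \<beta>' (H (y + 1)) / p 0 0 * (\<Prod>x\<in>{a..y + 1}. W x)"
    unfolding ivl rec[OF step.prems, symmetric] by simp
  finally show ?case unfolding E_def .
qed

(* p b j is the relative weight of the splitting of j paths leaving a column into j - b in the lower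
   row and b in the upper one; rec says that W intertwines these splittings. *)
lemma row_sum_fusion:
  fixes p :: "nat \<Rightarrow> nat \<Rightarrow> complex"
  assumes unit: "W 0 0 0 0 = 1" "W1 0 0 0 0 = 1" "W2 0 0 0 0 = 1"
    and W2: "\<And>i1 j1 i2 j2. j2 > 1 \<Longrightarrow> W2 i1 j1 i2 j2 = 0"
    and p00: "p 0 0 \<noteq> 0"
    and rec: "\<And>i1 j1 i2 j2 \<beta>'. \<beta>' \<le> 1 \<Longrightarrow> \<beta>' \<le> j2 \<Longrightarrow> i1 + j1 = i2 + j2 \<Longrightarrow>
       p \<beta>' j2 * W i1 j1 i2 j2 = (\<Sum>\<beta>\<in>{0, 1}. if \<beta> \<le> j1 \<and> \<beta> \<le> i2 + \<beta>'
          then p \<beta> j1 * (W1 i1 (j1 - \<beta>) (i2 + \<beta>' - \<beta>) (j2 - \<beta>') * W2 (i2 + \<beta>' - \<beta>) \<beta> i2 \<beta>') else 0)"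
  shows "(\<Sum>K | dominates M K \<and> dominates K N. row_sum W1 M K * row_sum W2 K N) = row_sum W M N"
proof (cases "dominates M N")
  case False
  then have "{K. dominates M K \<and> dominates K N} = {}" using dominates_trans by blast
  then show ?thesis using False by (simp only: row_sum_def if_False sum.empty)
next
  case MN: True
  obtain a b where ab: "a \<le> b" and Mab: "set_mset M \<subseteq> {a..b}" and Nab: "set_mset N \<subseteq> {a..b}"
    using mset_bounds by metis
  define H where "H = flux M N"
  have H0: "H x = 0" if "x < a \<or> b \<le> x" for x
    unfolding H_def using flux_eq_0[OF MN Mab Nab that] .
  have HM: "below M x = below N x + H x" for x
    using MN by (simp add: H_def flux_def dominates_def)
  \<comment> \<open>These inequalities make the truncated subtractions in \<open>G\<close> genuine.
    Required at all columns of the interval, they single out the sets \<open>B\<close> that come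
    from an intermediate multiset.\<close>
  define ok where "ok x \<beta> \<beta>' \<longleftrightarrow> \<beta> \<le> H (x - 1) \<and> \<beta>' \<le> H x \<and> \<beta> \<le> count N x + \<beta>'" for x \<beta> \<beta>'
  define G where "G x \<beta> \<beta>' = (if ok x \<beta> \<beta>' then
      W1 (count M x) (H (x - 1) - \<beta>) (count N x + \<beta>' - \<beta>) (H x - \<beta>')
      * W2 (count N x + \<beta>' - \<beta>) \<beta> (count N x) \<beta>' else 0)" for x \<beta> \<beta>'
  define bt where "bt B x = (of_bool (x \<in> B) :: nat)" for B and x :: int
  define S where "S = {K. dominates M K \<and> dominates K N}"
  \<comment> \<open>Outside \<open>S1\<close> some horizontal edge of the top row carries at least
    two paths, where \<open>W2\<close> is 0; inside, \<open>flux K N\<close> is the indicator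
    function of \<open>toB K\<close>.\<close>
  define S1 where "S1 = {K \<in> S. \<forall>x. flux K N x \<le> 1}"
  \<comment> \<open>Column \<open>a - 1\<close> is included to match \<open>column_sum\<close>;
    \<open>ok\<close> at column \<open>a\<close> excludes it from \<open>T1\<close>, because
    \<open>H (a - 1) = 0\<close>.\<close>
  define T where "T = Pow {a - 1..<b}"
  define T1 where "T1 = {B \<in> T. \<forall>x\<in>{a..b}. ok x (bt B (x - 1)) (bt B x)}"
  define toB where "toB K = {x. flux K N x = 1}" for K
  define toK where "toK B = N + mset_set B - image_mset (\<lambda>x. x + 1) (mset_set B)" for B
  have count_toK: "count (toK B) x = count N x + bt B x - bt B (x - 1)" if "finite B" for B x
  proof -
    have "image_mset (\<lambda>x. x + 1) (mset_set B) = mset_set ((\<lambda>x. x + 1) ` B)"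
      by (rule image_mset_mset_set) simp
    moreover have "x \<in> (\<lambda>x. x + 1) ` B \<longleftrightarrow> x - 1 \<in> B" for x by force
    ultimately show ?thesis using that by (auto simp: toK_def bt_def count_mset_set')
  qed
  have fS: "finite S" unfolding S_def by (rule finite_dominates_between)
  have fT: "finite T" by (simp add: T_def)
  have bt_toB: "bt (toB K) x = flux K N x" if "K \<in> S1" for K x
  proof -
    have "flux K N x \<le> 1" using that by (simp add: S1_def)
    then show ?thesis by (auto simp: bt_def toB_def)
  qed
  have belowK: "below K x = below N x + flux K N x" if "K \<in> S" for K x
    using that by (simp add: S_def flux_def dominates_def)
  have toB_sub: "toB K \<subseteq> {a..<b}" if "K \<in> S" for K
  proof
    fix x assume "x \<in> toB K"
    then have "flux K N x = 1" by (simp add: toB_def)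
    moreover have "set_mset K \<subseteq> {a..b}"
      using that dominates_between_bounds[OF _ _ Mab Nab] by (auto simp: S_def)
    ultimately show "x \<in> {a..<b}"
      using flux_eq_0[of K N a b x] that Nab by (force simp: S_def)
  qed
  have cK: "count K x + flux K N (x - 1) = count N x + flux K N x" if "K \<in> S" for K x
    using that flux_conserve by (simp add: S_def)
  have toB_T1: "toB K \<in> T1" if K: "K \<in> S1" for K
  proof -
    have KS: "K \<in> S" using K by (simp add: S1_def)
    have "flux K N x \<le> H x" for x
      using KS HM[of x] belowK[OF KS, of x] by (simp add: S_def dominates_def)
        (metis HM add_le_cancel_left)
    moreover have "flux K N (x - 1) \<le> count N x + flux K N x" for x
      using cK[OF KS, of x] by linarith
    ultimately show ?thesis
      using toB_sub[OF KS] by (auto simp: T1_def T_def ok_def bt_toB[OF K])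
  qed
  have toK_toB: "toK (toB K) = K" if K: "K \<in> S1" for K
  proof (rule multiset_eqI)
    fix x
    have KS: "K \<in> S" using K by (simp add: S1_def)
    have "finite (toB K)" using toB_sub[OF KS] finite_subset by blast
    then show "count (toK (toB K)) x = count K x"
      using cK[OF KS, of x] by (simp add: count_toK bt_toB[OF K])
  qed
  have T1: "toK B \<in> S1 \<and> toB (toK B) = B" if B: "B \<in> T1" for B
  proof -
    have Bsub: "B \<subseteq> {a - 1..<b}" and okB: "\<And>x. x \<in> {a..b} \<Longrightarrow> ok x (bt B (x - 1)) (bt B x)"
      using B by (auto simp: T1_def T_def)
    have fB: "finite B" using Bsub finite_subset by blast
    have btH: "bt B x \<le> H x" for x
    proof (cases "x \<in> {a - 1..<b}")
      case True
      then show ?thesis using okB[of "x + 1"] by (auto simp: ok_def)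
    next
      case False
      then have "x \<notin> B" using Bsub by blast
      then show ?thesis by (simp add: bt_def)
    qed
    have bal: "bt B (x - 1) \<le> count N x + bt B x" for x
    proof (cases "x \<in> {a..b}")
      case True
      then show ?thesis using okB[of x] by (auto simp: ok_def)
    next
      case False
      then have "x - 1 \<notin> B" using Bsub by auto
      then show ?thesis by (simp add: bt_def)
    qed
    have cnt: "count (toK B) x + of_bool (x - 1 \<in> B) = count N x + of_bool (x \<in> B)" for x
      using bal[of x] count_toK[OF fB, of x] by (simp add: bt_def)
    note bel = below_shift_by_set[OF fB cnt]
    have fl: "flux (toK B) N x = bt B x" for x
      by (simp add: flux_def bel(1) bt_def)
    have "dominates M (toK B)"
      using MN btH HM bel by (simp add: dominates_def bt_def)
    moreover have "dominates (toK B) N" using bel by (simp add: dominates_def)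
    moreover have "toB (toK B) = B" by (simp add: toB_def fl bt_def del: One_nat_def)
    ultimately show ?thesis
      by (simp add: S1_def S_def fl bt_def)
  qed
  have "(\<Sum>K\<in>S. row_sum W1 M K * row_sum W2 K N) = (\<Sum>K\<in>S1. row_sum W1 M K * row_sum W2 K N)"
  proof (rule sum.mono_neutral_right[OF fS])
    show "S1 \<subseteq> S" by (auto simp: S1_def)
    show "\<forall>K\<in>S - S1. row_sum W1 M K * row_sum W2 K N = 0"
    proof
      fix K assume "K \<in> S - S1"
      then obtain x where K: "K \<in> S" and x: "flux K N x > 1" by (auto simp: S1_def not_le)
      have Kab: "set_mset K \<subseteq> {a..b}" and KN: "dominates K N"
        using K dominates_between_bounds[OF _ _ Mab Nab] by (auto simp: S_def)
      have "x \<in> {a..b}" using flux_eq_0[OF KN Kab Nab, of x] x by fastforce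
      then have "row_sum W2 K N = 0"
        unfolding row_sum_interval[of W2, OF unit(3) KN Kab Nab] using W2[OF x] \<open>x \<in> {a..b}\<close>
        by (intro prod_zero) (auto intro!: bexI[of _ x])
      then show "row_sum W1 M K * row_sum W2 K N = 0" by simp
    qed
  qed
  also have "\<dots> = (\<Sum>B\<in>T1. \<Prod>x\<in>{a..b}. G x (bt B (x - 1)) (bt B x))"
  proof (rule sum.reindex_bij_witness[of _ toK toB])
    fix K assume K: "K \<in> S1"
    then have KS: "K \<in> S" by (simp add: S1_def)
    have Kab: "set_mset K \<subseteq> {a..b}" and MK: "dominates M K" and KN: "dominates K N"
      using KS dominates_between_bounds[OF _ _ Mab Nab] by (auto simp: S_def)
    have "flux M K x = H x - flux K N x" for x
      using HM[of x] belowK[OF KS, of x] by (simp add: flux_def)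
    moreover have "count K x = count N x + flux K N x - flux K N (x - 1)" for x
      using cK[OF KS, of x] by simp
    moreover have "ok x (flux K N (x - 1)) (flux K N x)" if "x \<in> {a..b}" for x
      using toB_T1[OF K] that by (auto simp: T1_def bt_toB[OF K])
    ultimately show "(\<Prod>x\<in>{a..b}. G x (bt (toB K) (x - 1)) (bt (toB K) x)) = row_sum W1 M K * row_sum W2 K N"
      unfolding row_sum_interval[of W1, OF unit(2) MK Mab Kab] row_sum_interval[of W2, OF unit(3) KN Kab Nab]
      by (simp add: G_def bt_toB[OF K] flip: prod.distrib)
  qed (use toB_T1 toK_toB T1 in auto)
  also have "\<dots> = (\<Sum>B\<in>T. \<Prod>x\<in>{a..b}. G x (bt B (x - 1)) (bt B x))"
  proof (rule sum.mono_neutral_left[OF fT])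
    show "\<forall>B\<in>T - T1. (\<Prod>x\<in>{a..b}. G x (bt B (x - 1)) (bt B x)) = 0"
      by (force simp: T1_def G_def)
  qed (auto simp: T1_def)
  also have "\<dots> = p 0 (H b) / p 0 0 * (\<Prod>x\<in>{a..b}. W (count M x) (H (x - 1)) (count N x) (H x))"
  proof -
    have "p \<beta>' (H x) * W (count M x) (H (x - 1)) (count N x) (H x)
       = (\<Sum>\<beta>\<in>{0, 1}. p \<beta> (H (x - 1)) * G x \<beta> \<beta>')" if "\<beta>' \<le> 1" "\<beta>' \<le> H x" for x \<beta>'
    proof -
      have "count M x + H (x - 1) = count N x + H x" unfolding H_def by (rule flux_conserve[OF MN])
      from rec[OF that this] show ?thesis
        using that by (simp add: G_def ok_def)
    qed
    then show ?thesis
      using column_sum[of H a p G "\<lambda>x. W (count M x) (H (x - 1)) (count N x) (H x)" b 0] H0 p00 ab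
      by (simp add: T_def bt_def G_def ok_def)
  qed
  \<comment> \<open>No path leaves column \<open>b\<close>, so \<open>H b = 0\<close> and the
    splitting weights at the two ends of the row cancel.\<close>
  also have "\<dots> = row_sum W M N"
    unfolding row_sum_interval[of W, OF unit(1) MN Mab Nab] H_def[symmetric] using p00 H0 by simp
  finally show ?thesis by (simp add: S_def)
qed

section \<open>Encoding up-right paths by the abscissae of their vertical steps\<close>

section \<open>Paths and their crossings\<close>

(* From (x, j), the path moves right to the first entry of the list, up one row, right to the
   second entry, and so on, and stops right after its last vertical step. *)
fun trail :: "int \<Rightarrow> int \<Rightarrow> int list \<Rightarrow> vertex list" where
  "trail x j [] = [(x, j)]"
| "trail x j (p # ps) = map (\<lambda>y. (y, j)) [x..p] @ trail p (j + 1) ps"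

lemma path_edges_simps [simp]:
  "path_edges [] = {}" "path_edges [a] = {}"
  "path_edges (a # b # P) = insert (a, b) (path_edges (b # P))"
  by (simp_all add: path_edges_def)

lemma path_edges_append:
  "P \<noteq> [] \<Longrightarrow> Q \<noteq> [] \<Longrightarrow> path_edges (P @ Q) = insert (last P, hd Q) (path_edges P \<union> path_edges Q)"
proof (induction P rule: induct_list012)
  case (2 a)
  then show ?case by (cases Q) auto
qed auto

lemma trail_neq_Nil [simp]: "trail x j ps \<noteq> []"
  by (induction ps arbitrary: x j) auto

lemma hd_trail: "sorted (x # ps) \<Longrightarrow> hd (trail x j ps) = (x, j)"
  by (cases ps) (auto simp: upto_rec1)

lemma last_trail: "last (trail x j ps) = (last (x # ps), j + int (length ps))"
  by (induction ps arbitrary: x j) auto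

lemma path_edges_horizontal:
  "path_edges (map (\<lambda>y. (y, j)) [x..p]) = {((y, j), (y + 1, j)) |y. x \<le> y \<and> y < p}"
proof (induction x p rule: upto.induct)
  case (1 x p)
  consider "p < x" | "p = x" | "x < p" by linarith
  then show ?case
  proof cases
    case 3
    then have "[x..p] = x # (x + 1) # [x + 1 + 1..p]" and r: "[x + 1..p] = (x + 1) # [x + 1 + 1..p]"
      by (simp_all add: upto_rec1)
    then have "path_edges (map (\<lambda>y. (y, j)) [x..p])
        = insert ((x, j), (x + 1, j)) (path_edges (map (\<lambda>y. (y, j)) [x + 1..p]))"
      by simp
    also have "\<dots> = {((y, j), (y + 1, j)) |y. x \<le> y \<and> y < p}"
      using 1 3 by (auto simp: order_le_less)
    finally show ?thesis .
  qed auto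
qed

lemma path_edges_trail_Cons:
  assumes "sorted (x # p # ps)"
  shows "path_edges (trail x j (p # ps)) = insert ((p, j), (p, j + 1))
     ({((y, j), (y + 1, j)) |y. x \<le> y \<and> y < p} \<union> path_edges (trail p (j + 1) ps))"
proof -
  have "x \<le> p" using assms by simp
  then have "last [x..p] = p" by (simp add: upto_rec2)
  moreover have "hd (trail p (j + 1) ps) = (p, j + 1)" using assms by (intro hd_trail) simp
  ultimately show ?thesis
    using \<open>x \<le> p\<close> by (simp add: path_edges_append path_edges_horizontal last_map)
qed

lemma ex_less_Suc_iff: "(\<exists>i<Suc n. Q i) \<longleftrightarrow> Q 0 \<or> (\<exists>i<n. Q (Suc i))"
  using less_Suc_eq_0_disj by auto

lemma vertical_edge_trail:
  "sorted (x # ps) \<Longrightarrow>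
   ((y, r), (y, r + 1)) \<in> path_edges (trail x j ps) \<longleftrightarrow> (\<exists>i<length ps. r = j + int i \<and> y = ps ! i)"
proof (induction ps arbitrary: x j)
  case (Cons p ps)
  have "sorted (p # ps)" using Cons.prems by simp
  then show ?case
    unfolding path_edges_trail_Cons[OF Cons.prems] length_Cons ex_less_Suc_iff
    using Cons.IH[of p "j + 1"] by (auto simp: algebra_simps)
qed simp

lemma horizontal_edge_trail:
  "sorted (x # ps) \<Longrightarrow>
   ((y, r), (y + 1, r)) \<in> path_edges (trail x j ps)
   \<longleftrightarrow> (\<exists>i<length ps. r = j + int i \<and> (x # ps) ! i \<le> y \<and> y < ps ! i)"
proof (induction ps arbitrary: x j)
  case (Cons p ps)
  have "sorted (p # ps)" using Cons.prems by simp
  then show ?case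
    unfolding path_edges_trail_Cons[OF Cons.prems] length_Cons ex_less_Suc_iff
    using Cons.IH[of p "j + 1"] by (auto simp: algebra_simps)
qed simp

lemma set_trail:
  "sorted (x # ps) \<Longrightarrow>
   (y, r) \<in> set (trail x j ps)
   \<longleftrightarrow> (\<exists>i<length ps. r = j + int i \<and> (x # ps) ! i \<le> y \<and> y \<le> ps ! i)
       \<or> y = last (x # ps) \<and> r = j + int (length ps)"
proof (induction ps arbitrary: x j)
  case (Cons p ps)
  have "sorted (p # ps)" using Cons.prems by simp
  then show ?case
    unfolding length_Cons ex_less_Suc_iff
    using Cons.IH[of p "j + 1"] by (auto simp: algebra_simps)
qed simp

lemma up_right_path_trail: "sorted (x # ps) \<Longrightarrow> up_right_path (trail x j ps)"
proof (induction ps arbitrary: x j)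
  case Nil
  then show ?case by (simp add: up_right_path_def)
next
  case (Cons p ps)
  have xp: "x \<le> p" and s: "sorted (p # ps)" using Cons.prems by auto
  have "successively (\<lambda>x y. y = (fst x + 1, snd x) \<or> y = (fst x, snd x + 1)) (map (\<lambda>y. (y, j)) [x..p])"
  proof (induction x p rule: upto.induct)
    case (1 x p)
    then show ?case
      by (cases "x < p") (auto simp: upto_rec1 upto.simps[of x p] successively_Cons)
  qed
  moreover have "last (map (\<lambda>y. (y, j)) [x..p]) = (p, j)"
    using xp by (simp add: last_map upto_rec2)
  ultimately show ?case
    using Cons.IH[OF s, of "j + 1"] hd_trail[OF s, of "j + 1"] xp
    by (auto simp: up_right_path_def successively_append_iff)
qed

lemma last_edge_append: "last_edge (P @ [a, b]) = (a, b)"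
  by (simp add: last_edge_def nth_append)

lemma last_edge_Cons: "length P \<ge> 2 \<Longrightarrow> last_edge (a # P) = last_edge P"
  by (cases P rule: rev_cases; cases "butlast P" rule: rev_cases)
     (auto simp: last_edge_def nth_append nth_Cons' Suc_le_eq)

lemma trail_snoc:
  "sorted (x # ps) \<Longrightarrow> ps \<noteq> [] \<Longrightarrow>
   \<exists>P. trail x j ps = P @ [(last ps, j + int (length ps) - 1), (last ps, j + int (length ps))]"
proof (induction ps arbitrary: x j)
  case (Cons p ps)
  show ?case
  proof (cases "ps = []")
    case True
    then show ?thesis using Cons.prems by (simp add: upto_rec2)
  next
    case False
    with Cons.IH[of p "j + 1"] Cons.prems
    obtain P where "trail p (j + 1) ps = P @ [(last ps, j + 1 + int (length ps) - 1), (last ps, j + 1 + int (length ps))]"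
      by auto
    then show ?thesis using False by (simp add: algebra_simps)
  qed
qed simp

text \<open>Induction on the first vertex: a horizontal step moves the start of the same list, a
  vertical one prepends \<open>x\<close>. The condition on the last edge excludes a final horizontal
  run, which \<open>trail\<close> cannot express; it is conditional so that a single vertex is
  covered.\<close>

lemma path_trail:
  assumes "up_right_path P" and "hd P = (x, j)" and "last P = (l, k)"
    and "length P \<ge> 2 \<Longrightarrow> \<exists>l k. last_edge P = ((l, k), (l, k + 1))"
  shows "\<exists>ps. P = trail x j ps \<and> sorted (x # ps) \<and> last (x # ps) = l \<and> k = j + int (length ps)"
  using assms
proof (induction P arbitrary: x j)
  case Nil
  then show ?case by (simp add: up_right_path_def)
next
  case (Cons a P)
  have a: "a = (x, j)" using Cons.prems by simp
  show ?case
  proof (cases "P = []")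
    case True
    with Cons.prems a have "a # P = trail x j [] \<and> sorted [x] \<and> last [x] = l \<and> k = j" by simp
    then show ?thesis by (metis add_0_right list.size(3) of_nat_0)
  next
    case False
    then obtain b Q where P: "P = b # Q" by (cases P) auto
    have urP: "up_right_path P" using Cons.prems P by (simp add: up_right_path_def)
    have lP: "last P = (l, k)" using Cons.prems False by simp
    have le: "length P \<ge> 2 \<Longrightarrow> \<exists>l k. last_edge P = ((l, k), (l, k + 1))"
      using Cons.prems(4) by (simp add: last_edge_Cons)
    consider "b = (x + 1, j)" | "b = (x, j + 1)"
      using Cons.prems a P by (auto simp: up_right_path_def)
    then show ?thesis
    proof cases
      case 1
      then obtain ps where ps: "P = trail (x + 1) j ps" "sorted ((x + 1) # ps)"
        "last ((x + 1) # ps) = l" "k = j + int (length ps)"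
        using Cons.IH[OF urP _ lP le] P by auto
      have "ps \<noteq> []"
      proof
        assume "ps = []"
        then have "last_edge (a # P) = ((x, j), (x + 1, j))" using ps a by (simp add: last_edge_def)
        with Cons.prems(4) P show False by auto
      qed
      then obtain p ps' where p: "ps = p # ps'" by (cases ps) auto
      then have "x \<le> p" using ps by simp
      then have "[x..p] = x # [x + 1..p]" by (simp add: upto_rec1)
      then have "a # P = trail x j ps" using ps a p by simp
      moreover have "sorted (x # ps)" using ps by auto
      moreover have "last (x # ps) = l" using ps p by simp
      ultimately show ?thesis using ps(4) by blast
    next
      case 2
      then obtain ps where ps: "P = trail x (j + 1) ps" "sorted (x # ps)"
        "last (x # ps) = l" "k = j + 1 + int (length ps)"
        using Cons.IH[OF urP _ lP le] P by auto
      then have "a # P = trail x j (x # ps)" using a by simp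
      moreover have "sorted (x # x # ps)" using ps by simp
      moreover have "last (x # x # ps) = l" "k = j + int (length (x # ps))" using ps by simp_all
      ultimately show ?thesis by blast
    qed
  qed
qed

text \<open>Starting at the first crossing makes the run in row 0 trivial, so that the first edge is
  vertical.\<close>

definition crossing_path :: "int list \<Rightarrow> vertex list" where
  "crossing_path ps = trail (hd ps) 0 ps"

definition crossings :: "nat \<Rightarrow> int list set" where
  "crossings k = {ps. length ps = Suc k \<and> sorted ps}"

lemma crossings_sorted:
  assumes "ps \<in> crossings k"
  shows "sorted (hd ps # ps)"
  using assms by (cases ps) (auto simp: crossings_def)

lemma crossing_path_ends:
  assumes "ps \<in> crossings k"
  shows "up_right_path (crossing_path ps)" and "length (crossing_path ps) \<ge> 2"
    and "first_edge (crossing_path ps) = ((ps ! 0, 0), (ps ! 0, 1))"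
    and "last_edge (crossing_path ps) = ((ps ! k, int k), (ps ! k, int k + 1))"
proof -
  have s: "sorted (hd ps # ps)" by (rule crossings_sorted[OF assms])
  have ne: "ps \<noteq> []" and len: "length ps = Suc k" using assms by (auto simp: crossings_def)
  show "up_right_path (crossing_path ps)"
    unfolding crossing_path_def by (rule up_right_path_trail[OF s])
  have last: "last ps = ps ! k" using ne len by (simp add: last_conv_nth)
  obtain P where P: "crossing_path ps = P @ [(ps ! k, int k), (ps ! k, int k + 1)]"
    using trail_snoc[OF s ne, of 0] len last by (auto simp: crossing_path_def)
  show "length (crossing_path ps) \<ge> 2" by (simp add: P)
  show "last_edge (crossing_path ps) = ((ps ! k, int k), (ps ! k, int k + 1))"
    by (simp add: P last_edge_append)
  obtain p ps' where ps: "ps = p # ps'" using ne by (cases ps) auto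
  have "sorted (p # ps')" using s ps by simp
  then have "hd (trail p 1 ps') = (p, 1)" by (rule hd_trail)
  then show "first_edge (crossing_path ps) = ((ps ! 0, 0), (ps ! 0, 1))"
    by (simp add: ps crossing_path_def first_edge_def hd_conv_nth)
qed

lemma path_crossings:
  assumes "up_right_path P" "length P \<ge> 2"
    and first: "first_edge P = ((m, 0), (m, 1))"
    and last: "last_edge P = ((l, int k), (l, int k + 1))"
  shows "\<exists>ps\<in>crossings k. P = crossing_path ps"
proof -
  have ne: "P \<noteq> []" using assms(2) by auto
  have "hd P = (m, 0)" using first ne by (simp add: first_edge_def hd_conv_nth)
  moreover have "last P = (l, int k + 1)" using last ne by (simp add: last_edge_def last_conv_nth)
  ultimately obtain ps where ps: "P = trail m 0 ps" "sorted (m # ps)" "int k + 1 = int (length ps)"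
    using path_trail[OF assms(1), of m 0 l "int k + 1"] last by auto
  then obtain p ps' where p: "ps = p # ps'" by (cases ps) auto
  \<comment> \<open>Otherwise the path would begin with a horizontal step in row 0.\<close>
  have "p = m"
  proof (rule ccontr)
    assume "p \<noteq> m"
    then have "m < p" using ps p by simp
    then have "P ! 1 = (m + 1, 0)" using ps p by (simp add: upto_rec1)
    with first show False by (simp add: first_edge_def)
  qed
  then show ?thesis using ps p by (intro bexI[of _ ps]) (auto simp: crossing_path_def crossings_def)
qed

text \<open>The prescribed end edges force every path to be a crossing path. The multiset
  \<open>X\<close> keeps multiplicities, and prescribes no pairing of starting points with end
  points.\<close>

lemma collections_iff:
  "C \<in> collections k \<nu> \<mu> \<longleftrightarrow>
   (\<exists>X. C = image_mset crossing_path X \<and> set_mset X \<subseteq> crossings k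
      \<and> image_mset (\<lambda>ps. ps ! 0) X = mset \<mu> \<and> image_mset (\<lambda>ps. ps ! k) X = mset \<nu>)"
proof
  assume C: "C \<in> collections k \<nu> \<mu>"
  have "\<exists>ps\<in>crossings k. P = crossing_path ps" if P: "P \<in># C" for P
  proof -
    have "first_edge P \<in># image_mset first_edge C" "last_edge P \<in># image_mset last_edge C"
      using P by simp_all
    moreover have "image_mset first_edge C = image_mset (\<lambda>m. ((m, 0), (m, 1))) (mset \<mu>)"
      "image_mset last_edge C = image_mset (\<lambda>l. ((l, int k), (l, int k + 1))) (mset \<nu>)"
      using C by (simp_all add: collections_def)
    ultimately obtain m l where "first_edge P = ((m, 0), (m, 1))" "last_edge P = ((l, int k), (l, int k + 1))"
      by (metis (no_types, lifting) imageE set_image_mset)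
    moreover have "up_right_path P" "length P \<ge> 2" using C P by (auto simp: collections_def)
    ultimately show ?thesis by (intro path_crossings)
  qed
  then obtain f where f: "\<And>P. P \<in># C \<Longrightarrow> f P \<in> crossings k \<and> P = crossing_path (f P)"
    by metis
  define X where "X = image_mset f C"
  have CX: "C = image_mset crossing_path X"
  proof -
    have "image_mset crossing_path X = image_mset (\<lambda>P. crossing_path (f P)) C"
      by (simp add: X_def image_mset.compositionality o_def)
    also have "\<dots> = image_mset (\<lambda>P. P) C"
      by (rule image_mset_cong) (use f in auto)
    finally show ?thesis by simp
  qed
  have Xk: "set_mset X \<subseteq> crossings k" using f by (auto simp: X_def)
  have "image_mset (\<lambda>ps. ps ! 0) X = image_mset (\<lambda>e. fst (fst e)) (image_mset first_edge C)"
    unfolding CX image_mset.compositionality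
    by (rule image_mset_cong) (use Xk crossing_path_ends(3) in auto)
  also have "\<dots> = mset \<mu>"
    using C by (simp add: collections_def image_mset.compositionality o_def flip: mset_map)
  finally have 1: "image_mset (\<lambda>ps. ps ! 0) X = mset \<mu>" .
  have "image_mset (\<lambda>ps. ps ! k) X = image_mset (\<lambda>e. fst (fst e)) (image_mset last_edge C)"
    unfolding CX image_mset.compositionality
    by (rule image_mset_cong) (use Xk crossing_path_ends(4) in auto)
  also have "\<dots> = mset \<nu>"
    using C by (simp add: collections_def image_mset.compositionality o_def flip: mset_map)
  finally show "\<exists>X. C = image_mset crossing_path X \<and> set_mset X \<subseteq> crossings k
      \<and> image_mset (\<lambda>ps. ps ! 0) X = mset \<mu> \<and> image_mset (\<lambda>ps. ps ! k) X = mset \<nu>"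
    using CX Xk 1 by blast
next
  assume "\<exists>X. C = image_mset crossing_path X \<and> set_mset X \<subseteq> crossings k
      \<and> image_mset (\<lambda>ps. ps ! 0) X = mset \<mu> \<and> image_mset (\<lambda>ps. ps ! k) X = mset \<nu>"
  then obtain X where C: "C = image_mset crossing_path X" and X: "set_mset X \<subseteq> crossings k"
    and \<mu>: "mset \<mu> = image_mset (\<lambda>ps. ps ! 0) X" and \<nu>: "mset \<nu> = image_mset (\<lambda>ps. ps ! k) X"
    by auto
  have "image_mset first_edge C = image_mset (\<lambda>m. ((m, 0), (m, 1))) (mset \<mu>)"
    unfolding C \<mu> image_mset.compositionality
    by (rule image_mset_cong) (use X crossing_path_ends(3) in auto)
  moreover have "image_mset last_edge C = image_mset (\<lambda>l. ((l, int k), (l, int k + 1))) (mset \<nu>)"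
    unfolding C \<nu> image_mset.compositionality
    by (rule image_mset_cong) (use X crossing_path_ends(4) in auto)
  ultimately show "C \<in> collections k \<nu> \<mu>"
    using X crossing_path_ends(1,2) by (auto simp: collections_def C)
qed

section \<open>From collections to chains of multisets\<close>

definition slice :: "int list multiset \<Rightarrow> nat \<Rightarrow> int multiset" where
  "slice X r = image_mset (\<lambda>ps. ps ! r) X"

definition row_conf :: "nat \<Rightarrow> int multiset \<Rightarrow> int multiset \<Rightarrow> (vertex \<times> nat \<times> nat \<times> nat \<times> nat) set" where
  "row_conf r M N = (\<lambda>x. ((x, int r), (count M x, flux M N (x - 1), count N x, flux M N x)))
     ` {x. count M x + flux M N (x - 1) > 0}"

lemma edge_count_image:
  "edge_count (image_mset crossing_path X) e = size {#ps \<in># X. e \<in> path_edges (crossing_path ps)#}"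
  by (simp add: edge_count_def filter_mset_image_mset)

lemma size_filter_cong: "(\<And>a. a \<in># X \<Longrightarrow> Q a \<longleftrightarrow> R a) \<Longrightarrow> size {#a \<in># X. Q a#} = size {#a \<in># X. R a#}"
  by (metis filter_mset_cong)

lemma size_filter_pos: "size {#a \<in># X. Q a#} > 0 \<longleftrightarrow> (\<exists>a\<in>#X. Q a)"
  by (induction X) auto

lemma edge_count_vertical:
  assumes X: "set_mset X \<subseteq> crossings k" and "i \<le> k"
  shows "edge_count (image_mset crossing_path X) ((x, int i), (x, int i + 1)) = count (slice X i) x"
proof -
  have "((x, int i), (x, int i + 1)) \<in> path_edges (crossing_path ps) \<longleftrightarrow> ps ! i = x" if "ps \<in># X" for ps
  proof -
    have "ps \<in> crossings k" using that X by auto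
    then show ?thesis
      using vertical_edge_trail[OF crossings_sorted, of ps k x "int i" 0] \<open>i \<le> k\<close>
      by (auto simp: crossing_path_def crossings_def)
  qed
  then have "edge_count (image_mset crossing_path X) ((x, int i), (x, int i + 1)) = size {#ps \<in># X. ps ! i = x#}"
    unfolding edge_count_image by (rule size_filter_cong)
  also have "\<dots> = count (slice X i) x"
    unfolding slice_def by (induction X) auto
  finally show ?thesis .
qed

text \<open>The number of intervals \<open>[f a, g a)\<close> containing \<open>x\<close> depends
  only on the multisets of left and of right ends. Hence the horizontal edge counts do not see how
  crossings of adjacent levels are joined.\<close>

lemma size_filter_between:
  fixes f g :: "'a \<Rightarrow> int"
  assumes "\<And>a. a \<in># X \<Longrightarrow> f a \<le> g a"
  shows "size {#a \<in># X. f a \<le> x \<and> x < g a#} + below (image_mset g X) x = below (image_mset f X) x"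
  using assms
proof (induction X)
  case (add a X)
  have "f a \<le> g a" using add.prems by simp
  moreover have "size {#a \<in># X. f a \<le> x \<and> x < g a#} + below (image_mset g X) x = below (image_mset f X) x"
    using add by simp
  ultimately show ?case by (auto simp: below_def)
qed (simp add: below_def)

lemma crossings_mono: "ps \<in> crossings k \<Longrightarrow> i \<le> i' \<Longrightarrow> i' \<le> k \<Longrightarrow> ps ! i \<le> ps ! i'"
  by (auto simp: crossings_def intro: sorted_nth_mono)

lemma edge_count_horizontal:
  assumes X: "set_mset X \<subseteq> crossings k" and i: "1 \<le> i" "i \<le> k"
  shows "edge_count (image_mset crossing_path X) ((x, int i), (x + 1, int i)) = flux (slice X (i - 1)) (slice X i) x"
proof -
  have "((x, int i), (x + 1, int i)) \<in> path_edges (crossing_path ps) \<longleftrightarrow> ps ! (i - 1) \<le> x \<and> x < ps ! i"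
    if "ps \<in># X" for ps
  proof -
    have "ps \<in> crossings k" using that X by auto
    then show ?thesis
      using horizontal_edge_trail[OF crossings_sorted, of ps k x "int i" 0] i
      by (auto simp: crossing_path_def crossings_def nth_Cons')
  qed
  then have "edge_count (image_mset crossing_path X) ((x, int i), (x + 1, int i))
      = size {#ps \<in># X. ps ! (i - 1) \<le> x \<and> x < ps ! i#}"
    unfolding edge_count_image by (rule size_filter_cong)
  moreover have "size {#ps \<in># X. ps ! (i - 1) \<le> x \<and> x < ps ! i#} + below (slice X i) x = below (slice X (i - 1)) x"
    unfolding slice_def using X i by (intro size_filter_between crossings_mono[of _ k]) auto
  ultimately show ?thesis by (simp add: flux_def)
qed

lemma dominates_slice:
  assumes X: "set_mset X \<subseteq> crossings k" and i: "1 \<le> i" "i \<le> k"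
  shows "dominates (slice X (i - 1)) (slice X i)"
proof -
  have "size {#ps \<in># X. ps ! (i - 1) \<le> x \<and> x < ps ! i#} + below (slice X i) x = below (slice X (i - 1)) x" for x
    unfolding slice_def using X i by (intro size_filter_between crossings_mono[of _ k]) auto
  then have "below (slice X i) x \<le> below (slice X (i - 1)) x" for x by (rule subst) simp
  then show ?thesis by (simp add: dominates_def slice_def)
qed

text \<open>The two end vertices are the only vertices at heights 0 and \<open>k + 1\<close>, so
  removing them leaves exactly the runs in rows 1 to \<open>k\<close>.\<close>

lemma path_interior_crossing_path:
  assumes ps: "ps \<in> crossings k"
  shows "path_interior (crossing_path ps) = {(y, int i) |y i. 1 \<le> i \<and> i \<le> k \<and> ps ! (i - 1) \<le> y \<and> y \<le> ps ! i}"
proof -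
  have s: "sorted (hd ps # ps)" by (rule crossings_sorted[OF ps])
  have ne: "ps \<noteq> []" and len: "length ps = Suc k" using ps by (auto simp: crossings_def)
  have hd0: "hd ps = ps ! 0" using ne by (simp add: hd_conv_nth)
  have "(y, r) \<in> path_interior (crossing_path ps)
     \<longleftrightarrow> (\<exists>i. r = int i \<and> 1 \<le> i \<and> i \<le> k \<and> ps ! (i - 1) \<le> y \<and> y \<le> ps ! i)" for y r
  proof -
    have "(\<exists>i. r = int i \<and> 1 \<le> i \<and> i \<le> k \<and> ps ! (i - 1) \<le> y \<and> y \<le> ps ! i)
      \<longleftrightarrow> (\<exists>i<k. r = int (Suc i) \<and> ps ! i \<le> y \<and> y \<le> ps ! Suc i)" (is "?L \<longleftrightarrow> ?R")
    proof
      assume ?L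
      then obtain i where i: "r = int i" "1 \<le> i" "i \<le> k" "ps ! (i - 1) \<le> y" "y \<le> ps ! i" by blast
      then obtain m where "i = Suc m" by (cases i) auto
      with i show ?R by (intro exI[of _ m]) auto
    next
      assume ?R
      then obtain i where "i < k" "r = int (Suc i)" "ps ! i \<le> y" "y \<le> ps ! Suc i" by blast
      then show ?L by (intro exI[of _ "Suc i"]) auto
    qed
    then show ?thesis
      unfolding path_interior_def crossing_path_def Diff_iff set_trail[OF s] hd_trail[OF s] last_trail len ex_less_Suc_iff
      using hd0 by auto
  qed
  then show ?thesis by auto
qed

text \<open>Edge counts depend on the slices alone. The supports agree because a path visiting
  column \<open>x\<close> in row \<open>r\<close> either crosses into the row at \<open>x\<close> or
  arrives there from column \<open>x - 1\<close>.\<close>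

lemma configuration_crossings:
  assumes X: "set_mset X \<subseteq> crossings k"
  shows "configuration (image_mset crossing_path X) = (\<Union>r\<in>{1..k}. row_conf r (slice X (r - 1)) (slice X r))"
proof -
  let ?C = "image_mset crossing_path X"
  have state: "vertex_state ?C (x, int r) = (count (slice X (r - 1)) x,
      flux (slice X (r - 1)) (slice X r) (x - 1), count (slice X r) x, flux (slice X (r - 1)) (slice X r) x)"
    if "r \<in> {1..k}" for x r
  proof -
    have e: "int (r - 1) = int r - 1" using that by (simp add: of_nat_diff)
    have v1: "edge_count ?C ((x, int r - 1), (x, int r)) = count (slice X (r - 1)) x"
    proof -
      have "r - 1 \<le> k" using that by auto
      from edge_count_vertical[OF X this, of x] show ?thesis unfolding e by simp
    qed
    have v2: "edge_count ?C ((x, int r), (x, int r + 1)) = count (slice X r) x"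
      using edge_count_vertical[OF X, of r x] that by simp
    have h1: "edge_count ?C ((x - 1, int r), (x, int r)) = flux (slice X (r - 1)) (slice X r) (x - 1)"
      using edge_count_horizontal[OF X, of r "x - 1"] that by simp
    have h2: "edge_count ?C ((x, int r), (x + 1, int r)) = flux (slice X (r - 1)) (slice X r) x"
      using edge_count_horizontal[OF X, of r x] that by simp
    show ?thesis by (simp only: vertex_state.simps v1 v2 h1 h2)
  qed
  have pos: "count (slice X (r - 1)) x + flux (slice X (r - 1)) (slice X r) (x - 1) > 0
      \<longleftrightarrow> (\<exists>ps\<in>#X. ps ! (r - 1) \<le> x \<and> x \<le> ps ! r)" (is "?L \<longleftrightarrow> ?R") if r: "r \<in> {1..k}" for x r
  proof -
    have mono: "ps ! (r - 1) \<le> ps ! r" if "ps \<in># X" for ps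
      using X that r by (intro crossings_mono[of _ k]) auto
    have "flux (slice X (r - 1)) (slice X r) (x - 1) = size {#ps \<in># X. ps ! (r - 1) \<le> x - 1 \<and> x - 1 < ps ! r#}"
      unfolding flux_def slice_def
      using size_filter_between[of X "\<lambda>ps. ps ! (r - 1)" "\<lambda>ps. ps ! r" "x - 1", OF mono] by linarith
    then have "?L \<longleftrightarrow> (\<exists>ps\<in>#X. ps ! (r - 1) = x) \<or> (\<exists>ps\<in>#X. ps ! (r - 1) \<le> x - 1 \<and> x - 1 < ps ! r)"
      by (auto simp: slice_def size_filter_pos)
    also have "\<dots> \<longleftrightarrow> (\<exists>ps\<in>#X. ps ! (r - 1) = x \<or> ps ! (r - 1) \<le> x - 1 \<and> x - 1 < ps ! r)"
      by (simp only: bex_disj_distrib)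
    also have "\<dots> \<longleftrightarrow> ?R"
    proof (rule bex_cong[OF refl])
      fix ps assume "ps \<in># X"
      from mono[OF this]
      show "(ps ! (r - 1) = x \<or> ps ! (r - 1) \<le> x - 1 \<and> x - 1 < ps ! r) \<longleftrightarrow> (ps ! (r - 1) \<le> x \<and> x \<le> ps ! r)"
        by arith
    qed
    finally show ?thesis .
  qed
  have "collection_interior ?C = {(x, int r) |x r. r \<in> {1..k} \<and> (\<exists>ps\<in>#X. ps ! (r - 1) \<le> x \<and> x \<le> ps ! r)}"
  proof -
    have "collection_interior ?C = (\<Union>ps\<in>set_mset X. path_interior (crossing_path ps))"
      by (simp add: collection_interior_def)
    also have "\<dots> = (\<Union>ps\<in>set_mset X. {(y, int i) |y i. 1 \<le> i \<and> i \<le> k \<and> ps ! (i - 1) \<le> y \<and> y \<le> ps ! i})"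
      using X by (intro SUP_cong refl path_interior_crossing_path) auto
    also have "\<dots> = {(x, int r) |x r. r \<in> {1..k} \<and> (\<exists>ps\<in>#X. ps ! (r - 1) \<le> x \<and> x \<le> ps ! r)}"
      by auto
    finally show ?thesis .
  qed
  also have "\<dots> = (\<Union>r\<in>{1..k}. (\<lambda>x. (x, int r)) ` {x. \<exists>ps\<in>#X. ps ! (r - 1) \<le> x \<and> x \<le> ps ! r})"
    by blast
  also have "\<dots> = (\<Union>r\<in>{1..k}. (\<lambda>x. (x, int r)) ` {x. count (slice X (r - 1)) x + flux (slice X (r - 1)) (slice X r) (x - 1) > 0})"
    by (intro SUP_cong refl arg_cong2[of _ _ _ _ image] Collect_cong pos[symmetric])
  finally show ?thesis
    unfolding configuration_def row_conf_def
    using state by (simp add: image_UN image_image)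
qed

text \<open>If it failed, \<open>n + 1\<close> entries of \<open>ys\<close> but at most
  \<open>n\<close> entries of \<open>xs\<close> would be at most \<open>ys ! n\<close>, against
  dominance.\<close>

lemma sorted_nth_le_dominated:
  assumes "sorted xs" "sorted ys" "dominates (mset xs) (mset ys)" "n < length xs"
  shows "xs ! n \<le> ys ! n"
proof (rule ccontr)
  assume "\<not> xs ! n \<le> ys ! n"
  then have less: "ys ! n < xs ! n" by simp
  have len: "length ys = length xs" using assms(3) by (simp add: dominates_def)
  have below_card: "below (mset zs) x = card {i. i < length zs \<and> zs ! i \<le> x}" for zs x
    by (simp add: below_def length_filter_conv_card flip: mset_filter)
  have "{i. i < length xs \<and> xs ! i \<le> ys ! n} \<subseteq> {..<n}"
  proof
    fix i assume i: "i \<in> {i. i < length xs \<and> xs ! i \<le> ys ! n}"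
    show "i \<in> {..<n}"
    proof (rule ccontr)
      assume "i \<notin> {..<n}"
      then have "xs ! n \<le> xs ! i" using i assms(1) by (intro sorted_nth_mono) auto
      with less i show False by simp
    qed
  qed
  then have "below (mset xs) (ys ! n) \<le> n"
    unfolding below_card by (metis card_lessThan card_mono finite_lessThan)
  moreover have "{..n} \<subseteq> {i. i < length ys \<and> ys ! i \<le> ys ! n}"
    using assms(2,4) len by (auto intro: sorted_nth_mono)
  then have "card {..n} \<le> below (mset ys) (ys ! n)"
    unfolding below_card by (intro card_mono) auto
  moreover have "below (mset ys) (ys ! n) \<le> below (mset xs) (ys ! n)"
    using assms(3) by (simp add: dominates_def)
  ultimately show False by simp
qed

definition chain_conf :: "nat \<Rightarrow> (nat \<Rightarrow> int multiset) \<Rightarrow> (vertex \<times> nat \<times> nat \<times> nat \<times> nat) set" where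
  "chain_conf k Ms = (\<Union>r\<in>{1..k}. row_conf r (Ms (r - 1)) (Ms r))"

lemma configurations_eq_chains:
  "configuration ` collections k \<nu> \<mu> =
   {chain_conf k Ms |Ms. Ms 0 = mset \<mu> \<and> Ms k = mset \<nu> \<and> (\<forall>r\<in>{1..k}. dominates (Ms (r - 1)) (Ms r))}"
  (is "?L = ?R")
proof (intro subset_antisym subsetI)
  fix c assume "c \<in> ?L"
  then obtain X where c: "c = configuration (image_mset crossing_path X)" and X: "set_mset X \<subseteq> crossings k"
    and "slice X 0 = mset \<mu>" "slice X k = mset \<nu>"
    by (auto simp: collections_iff slice_def)
  moreover have "\<forall>r\<in>{1..k}. dominates (slice X (r - 1)) (slice X r)"
    using dominates_slice[OF X] by simp
  moreover have "c = chain_conf k (slice X)"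
    unfolding c chain_conf_def by (rule configuration_crossings[OF X])
  ultimately show "c \<in> ?R" by blast
next
  fix c assume "c \<in> ?R"
  then obtain Ms where c: "c = chain_conf k Ms" and M0: "Ms 0 = mset \<mu>" and Mk: "Ms k = mset \<nu>"
    and dm: "\<And>r. r \<in> {1..k} \<Longrightarrow> dominates (Ms (r - 1)) (Ms r)"
    by blast
  define L where "L = length \<mu>"
  define S where "S r = sorted_list_of_multiset (Ms r)" for r
  \<comment> \<open>Of the many collections with these slices, take the one whose
    \<open>n\<close>-th path joins the \<open>n\<close>-th smallest points of all levels; dominance
    makes it move to the right.\<close>
  define X where "X = mset (map (\<lambda>n. map (\<lambda>r. S r ! n) [0..<Suc k]) [0..<L])"
  have len: "length (S r) = L" if "r \<le> k" for r
    using that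
  proof (induction r)
    case 0
    then show ?case by (simp add: S_def M0 L_def flip: size_mset)
  next
    case (Suc r)
    then have "dominates (Ms r) (Ms (Suc r))" using dm[of "Suc r"] by simp
    moreover have "size (Ms r) = L" using Suc by (simp add: S_def flip: size_mset)
    ultimately have "size (Ms (Suc r)) = L" by (simp add: dominates_def)
    then show ?case by (simp add: S_def flip: size_mset)
  qed
  have slice: "slice X r = Ms r" if "r \<le> k" for r
  proof -
    have "slice X r = mset (map (\<lambda>n. map (\<lambda>r. S r ! n) [0..<Suc k] ! r) [0..<L])"
      unfolding X_def slice_def by (simp only: mset_map image_mset.compositionality o_def)
    also have "(\<lambda>n. map (\<lambda>r. S r ! n) [0..<Suc k] ! r) = (\<lambda>n. S r ! n)"
      using that by (intro ext) (subst nth_map; simp del: upt_Suc)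
    also have "map (\<lambda>n. S r ! n) [0..<L] = S r"
      using len[OF that] map_nth[of "S r"] by simp
    also have "mset (S r) = Ms r" by (simp add: S_def)
    finally show ?thesis .
  qed
  have "S r ! n \<le> S (Suc r) ! n" if "n < L" "r < k" for n r
  proof (rule sorted_nth_le_dominated)
    show "dominates (mset (S r)) (mset (S (Suc r)))" using dm[of "Suc r"] that by (simp add: S_def)
    show "n < length (S r)" using len[of r] that by simp
  qed (auto simp: S_def)
  then have "sorted (map (\<lambda>r. S r ! n) [0..<Suc k])" if "n < L" for n
    using that unfolding sorted_iff_nth_Suc by (simp del: upt_Suc)
  then have X: "set_mset X \<subseteq> crossings k"
    by (auto simp: X_def crossings_def simp del: upt_Suc)
  have "image_mset crossing_path X \<in> collections k \<nu> \<mu>"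
    unfolding collections_iff using X slice[of 0] slice[of k] M0 Mk by (auto simp: slice_def)
  moreover have "configuration (image_mset crossing_path X) = c"
    unfolding c chain_conf_def configuration_crossings[OF X]
    by (intro SUP_cong refl arg_cong2[of _ _ _ _ "row_conf _"] slice) auto
  ultimately show "c \<in> ?L" by blast
qed

section \<open>Peeling off the top row from a sum over configurations\<close>

fun confs :: "nat \<Rightarrow> int multiset \<Rightarrow> int multiset \<Rightarrow> (vertex \<times> nat \<times> nat \<times> nat \<times> nat) set set" where
  "confs 0 M N = (if M = N then {{}} else {})"
| "confs (Suc k) M N = (\<Union>K\<in>{K. dominates K N}. (\<lambda>c. c \<union> row_conf (Suc k) K N) ` confs k M K)"

lemma chains_eq_confs:
  "{chain_conf k Ms |Ms. Ms 0 = M \<and> Ms k = N \<and> (\<forall>r\<in>{1..k}. dominates (Ms (r - 1)) (Ms r))} = confs k M N"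
proof (induction k arbitrary: N)
  case 0
  show ?case
  proof (cases "M = N")
    case True
    then show ?thesis by (auto simp: chain_conf_def intro: exI[of _ "\<lambda>_. N"])
  qed auto
next
  case (Suc k)
  have chain_Suc: "chain_conf (Suc k) Ms = chain_conf k Ms \<union> row_conf (Suc k) (Ms k) (Ms (Suc k))" for Ms
    by (auto simp: chain_conf_def atLeastAtMostSuc_conv)
  show ?case
  proof (intro subset_antisym subsetI)
    fix c assume "c \<in> {chain_conf (Suc k) Ms |Ms. Ms 0 = M \<and> Ms (Suc k) = N \<and> (\<forall>r\<in>{1..Suc k}. dominates (Ms (r - 1)) (Ms r))}"
    then obtain Ms where c: "c = chain_conf (Suc k) Ms" and Ms: "Ms 0 = M" "Ms (Suc k) = N"
      and dm: "\<forall>r\<in>{1..Suc k}. dominates (Ms (r - 1)) (Ms r)" by blast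
    have "chain_conf k Ms \<in> confs k M (Ms k)"
      unfolding Suc.IH[symmetric] using Ms dm by auto
    moreover have "dominates (Ms k) N" using dm[rule_format, of "Suc k"] Ms by simp
    ultimately show "c \<in> confs (Suc k) M N" using c chain_Suc Ms by auto
  next
    fix c assume "c \<in> confs (Suc k) M N"
    then obtain K c' where K: "dominates K N" and c: "c = c' \<union> row_conf (Suc k) K N" and c': "c' \<in> confs k M K"
      by auto
    from c'[folded Suc.IH] obtain Ms where Ms: "c' = chain_conf k Ms" "Ms 0 = M" "Ms k = K"
      and dm: "\<forall>r\<in>{1..k}. dominates (Ms (r - 1)) (Ms r)" by blast
    define Ms' where "Ms' = Ms(Suc k := N)"
    have eq: "Ms' r = Ms r" if "r \<le> k" for r using that by (simp add: Ms'_def)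
    have "chain_conf k Ms' = chain_conf k Ms"
      unfolding chain_conf_def by (intro SUP_cong refl arg_cong2[of _ _ _ _ "row_conf _"] eq) auto
    then have "c = chain_conf (Suc k) Ms'"
      unfolding chain_Suc c Ms(1) using eq[of k] Ms by (simp add: Ms'_def)
    moreover have "\<forall>r\<in>{1..Suc k}. dominates (Ms' (r - 1)) (Ms' r)"
    proof
      fix r assume r: "r \<in> {1..Suc k}"
      show "dominates (Ms' (r - 1)) (Ms' r)"
      proof (cases "r = Suc k")
        case True
        then show ?thesis using K Ms by (simp add: Ms'_def)
      next
        case False
        then have "r \<in> {1..k}" using r by auto
        then show ?thesis using dm eq[of r] eq[of "r - 1"] by auto
      qed
    qed
    moreover have "Ms' 0 = M" "Ms' (Suc k) = N" using Ms by (simp_all add: Ms'_def)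
    ultimately show "c \<in> {chain_conf (Suc k) Ms |Ms. Ms 0 = M \<and> Ms (Suc k) = N \<and> (\<forall>r\<in>{1..Suc k}. dominates (Ms (r - 1)) (Ms r))}"
      by blast
  qed
qed

definition conf_weight :: "(int \<Rightarrow> nat \<Rightarrow> nat \<Rightarrow> nat \<Rightarrow> nat \<Rightarrow> complex) \<Rightarrow> (vertex \<times> nat \<times> nat \<times> nat \<times> nat) set \<Rightarrow> complex" where
  "conf_weight W c = (\<Prod>((i, j), (i1, j1, i2, j2)) \<in> c. W j i1 j1 i2 j2)"

definition confs_sum :: "(int \<Rightarrow> nat \<Rightarrow> nat \<Rightarrow> nat \<Rightarrow> nat \<Rightarrow> complex) \<Rightarrow> nat \<Rightarrow> int multiset \<Rightarrow> int multiset \<Rightarrow> complex" where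
  "confs_sum W k M N = (\<Sum>c\<in>confs k M N. conf_weight W c)"

lemma path_sum_eq_confs_sum: "path_sum W k \<nu> \<mu> = confs_sum W k (mset \<mu>) (mset \<nu>)"
  unfolding path_sum_def confs_sum_def conf_weight_def configurations_eq_chains chains_eq_confs ..

lemma finite_row_conf:
  assumes "dominates M N"
  shows "finite (row_conf r M N)"
proof -
  obtain a b where M: "set_mset M \<subseteq> {a..b}" and N: "set_mset N \<subseteq> {a..b}" using mset_bounds by metis
  from row_support_subset[OF assms this]
  show ?thesis unfolding row_conf_def by (meson finite_atLeastAtMost_int finite_imageI finite_subset)
qed

lemma confs_props:
  assumes "c \<in> confs k M N"
  shows "dominates M N" and "finite c" and "\<And>i j w. ((i, j), w) \<in> c \<Longrightarrow> j \<le> int k"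
proof -
  have "dominates M N \<and> finite c \<and> (\<forall>i j w. ((i, j), w) \<in> c \<longrightarrow> j \<le> int k)"
    using assms
  proof (induction k arbitrary: N c)
    case 0
    then show ?case by (auto simp: dominates_refl split: if_splits)
  next
    case (Suc k)
    then obtain K c' where K: "dominates K N" and c: "c = c' \<union> row_conf (Suc k) K N" and c': "c' \<in> confs k M K"
      by auto
    have "dominates M N" using Suc.IH[OF c'] K dominates_trans by blast
    moreover have "finite c" using Suc.IH[OF c'] finite_row_conf[OF K] by (simp add: c)
    moreover have "j \<le> int (Suc k)" if "((i, j), w) \<in> c" for i j w
    proof -
      have "((i, j), w) \<in> c' \<Longrightarrow> j \<le> int k" using Suc.IH[OF c'] by blast
      then show ?thesis using that by (auto simp: c row_conf_def)
    qed
    ultimately show ?case by blast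
  qed
  then show "dominates M N" "finite c" "\<And>i j w. ((i, j), w) \<in> c \<Longrightarrow> j \<le> int k" by blast+
qed

lemma confs_Suc_image:
  "confs (Suc k) M N = (\<lambda>(K, c). c \<union> row_conf (Suc k) K N) ` (SIGMA K:{K. dominates M K \<and> dominates K N}. confs k M K)"
  using confs_props(1) by (fastforce simp: image_iff)

lemma finite_confs: "finite (confs k M N)"
proof (induction k arbitrary: N)
  case (Suc k)
  show ?case unfolding confs_Suc_image
    by (intro finite_imageI finite_SigmaI finite_dominates_between Suc.IH)
qed simp

lemma row_conf_subset_count:
  assumes "row_conf r M N \<subseteq> row_conf r M' N'" and "count M x > 0"
  shows "count M' x = count M x"
proof -
  have "((x, int r), (count M x, flux M N (x - 1), count N x, flux M N x)) \<in> row_conf r M N"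
    using assms(2) by (auto simp: row_conf_def)
  with assms(1) have "((x, int r), (count M x, flux M N (x - 1), count N x, flux M N x)) \<in> row_conf r M' N'"
    by blast
  then show ?thesis by (auto simp: row_conf_def)
qed

text \<open>The South counts recover \<open>M\<close>, as every point of \<open>M\<close> lies in
  the support. The upper multiset is already known when a top row is peeled off.\<close>

lemma row_conf_inject:
  assumes "row_conf r M N = row_conf r M' N'"
  shows "M = M'"
proof (rule multiset_eqI)
  fix x
  show "count M x = count M' x"
    using row_conf_subset_count[OF equalityD1[OF assms], of x] row_conf_subset_count[OF equalityD2[OF assms], of x]
    by linarith
qed

lemma conf_weight_row_conf:
  assumes "dominates M N"
  shows "conf_weight W (row_conf r M N) = row_sum (W (int r)) M N"
proof -
  have "inj_on (\<lambda>x. ((x, int r), (count M x, flux M N (x - 1), count N x, flux M N x))) A" for A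
    by (auto simp: inj_on_def)
  then show ?thesis
    using assms by (simp add: conf_weight_def row_conf_def row_sum_def prod.reindex)
qed

text \<open>Configurations are summed as sets, so no two pairs of a lower configuration and an
  intermediate multiset may give the same union. The height labels separate the top row from the
  rest, and the top row determines \<open>K\<close>.\<close>

lemma confs_sum_Suc:
  "confs_sum W (Suc k) M N
   = (\<Sum>K | dominates M K \<and> dominates K N. confs_sum W k M K * row_sum (W (int (Suc k))) K N)"
proof -
  let ?A = "{K. dominates M K \<and> dominates K N}"
  let ?h = "\<lambda>(K, c). c \<union> row_conf (Suc k) K N"
  have disj: "c \<inter> row_conf (Suc k) K N = {}" if "c \<in> confs k M K'" for c K K'
    using confs_props(3)[OF that] by (fastforce simp: row_conf_def)
  have top: "{e \<in> c \<union> row_conf (Suc k) K N. snd (fst e) = int (Suc k)} = row_conf (Suc k) K N"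
    if "c \<in> confs k M K'" for c K K'
    using confs_props(3)[OF that] by (fastforce simp: row_conf_def)
  have inj: "inj_on ?h (SIGMA K:?A. confs k M K)"
  proof (rule inj_onI, clarify)
    fix K c K' c'
    assume c: "c \<in> confs k M K" and c': "c' \<in> confs k M K'"
      and eq: "c \<union> row_conf (Suc k) K N = c' \<union> row_conf (Suc k) K' N"
    have "row_conf (Suc k) K N = row_conf (Suc k) K' N"
      using top[OF c, of K] top[OF c', of K'] eq by simp
    moreover from this have "c = c'" using eq disj[OF c, of K] disj[OF c', of K'] by blast
    ultimately show "K = K' \<and> c = c'" using row_conf_inject by blast
  qed
  have "confs_sum W (Suc k) M N = (\<Sum>(K, c)\<in>(SIGMA K:?A. confs k M K). conf_weight W (c \<union> row_conf (Suc k) K N))"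
    unfolding confs_sum_def confs_Suc_image sum.reindex[OF inj] by (simp add: case_prod_unfold)
  also have "\<dots> = (\<Sum>K\<in>?A. \<Sum>c\<in>confs k M K. conf_weight W (c \<union> row_conf (Suc k) K N))"
    using finite_dominates_between finite_confs by (subst sum.Sigma) auto
  also have "\<dots> = (\<Sum>K\<in>?A. \<Sum>c\<in>confs k M K. conf_weight W c * row_sum (W (int (Suc k))) K N)"
  proof (intro sum.cong refl)
    fix K c assume K: "K \<in> ?A" and c: "c \<in> confs k M K"
    have "conf_weight W (c \<union> row_conf (Suc k) K N) = conf_weight W c * conf_weight W (row_conf (Suc k) K N)"
      unfolding conf_weight_def
      using K confs_props(2)[OF c] disj[OF c, of K] finite_row_conf by (intro prod.union_disjoint) auto
    also have "conf_weight W (row_conf (Suc k) K N) = row_sum (W (int (Suc k))) K N"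
      using K by (intro conf_weight_row_conf) simp
    finally show "conf_weight W (c \<union> row_conf (Suc k) K N) = conf_weight W c * row_sum (W (int (Suc k))) K N" .
  qed
  finally show ?thesis by (simp add: confs_sum_def sum_distrib_right)
qed

lemma confs_sum_0 [simp]: "confs_sum W 0 M N = (if M = N then 1 else 0)"
  by (simp add: confs_sum_def conf_weight_def)

lemma confs_sum_cong:
  assumes "\<And>j. j \<le> int k \<Longrightarrow> W j = W' j"
  shows "confs_sum W k M N = confs_sum W' k M N"
  unfolding confs_sum_def conf_weight_def
proof (rule sum.cong[OF refl], rule prod.cong[OF refl], goal_cases)
  case (1 c e)
  obtain i j w where e: "e = ((i, j), w)" by (metis surj_pair)
  have "j \<le> int k" using confs_props(3)[OF 1(1)] 1(2) e by blast
  then show ?case using assms[of j] by (simp add: e)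
qed

lemma confs_sum_1: "confs_sum W 1 M N = row_sum (W 1) M N"
proof (cases "dominates M N")
  case True
  have "confs_sum W 1 M N = (\<Sum>K\<in>{M}. confs_sum W 0 M K * row_sum (W 1) K N)"
    unfolding One_nat_def confs_sum_Suc
    by (rule sum.mono_neutral_cong_right) (auto simp: finite_dominates_between dominates_refl True)
  then show ?thesis by simp
next
  case False
  then have "{K. dominates M K \<and> dominates K N} = {}" using dominates_trans by blast
  then show ?thesis
    unfolding One_nat_def confs_sum_Suc using False by (simp only: sum.empty row_sum_def if_False)
qed

section \<open>Three-term relations for the regularized \<open>4phi3\<close> series at argument
  \<open>q\<close>\<close>

section \<open>Contiguous relations for the terminating series\<close>

definition qpoch_nat :: "complex \<Rightarrow> complex \<Rightarrow> nat \<Rightarrow> complex" where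
  "qpoch_nat q x n = (\<Prod>r<n. 1 - x * q ^ r)"

lemma qpoch_nat_0 [simp]: "qpoch_nat q x 0 = 1"
  by (simp add: qpoch_nat_def)

lemma qpoch_nat_Suc: "qpoch_nat q x (Suc n) = qpoch_nat q x n * (1 - x * q ^ n)"
  by (simp add: qpoch_nat_def)

lemma qpoch_nat_rec: "qpoch_nat q x (Suc n) = (1 - x) * qpoch_nat q (x * q) n"
  unfolding qpoch_nat_def by (subst prod.lessThan_Suc_shift) (simp add: mult.assoc)

lemma qpoch_nat_shift: "(1 - x) * qpoch_nat q (x * q) n = qpoch_nat q x n * (1 - x * q ^ n)"
  by (metis qpoch_nat_Suc qpoch_nat_rec)

text \<open>Upper parameters \<open>x\<close>, \<open>y\<close>, \<open>e\<close> and lower ones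
  \<open>b\<close>, \<open>d\<close>, \<open>c\<close>. In the application \<open>x\<close>,
  \<open>y\<close>, \<open>d\<close>, \<open>c\<close> vary with the state or with \<open>J\<close>,
  whereas \<open>e = q s / v\<close> and \<open>b = s^2\<close> stay fixed.\<close>

definition term4 where
  "term4 q n x y e b d c k =
     q ^ k * qpoch_nat q (inverse q ^ n) k / qpoch_nat q q k * qpoch_nat q x k * qpoch_nat q y k * qpoch_nat q e k
     * qpoch_nat q (b * q ^ k) (n - k) * qpoch_nat q (d * q ^ k) (n - k) * qpoch_nat q (c * q ^ k) (n - k)"

definition Phi where
  "Phi q n x y e b d c = (\<Sum>k\<le>n. term4 q n x y e b d c k)"

lemma qpoch_nat_lower_shift:
  assumes "k \<le> n"
  shows "(1 - c * q ^ k) * qpoch_nat q (c * q * q ^ k) (n - k) = (1 - c * q ^ n) * qpoch_nat q (c * q ^ k) (n - k)"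
  using qpoch_nat_shift[of "c * q ^ k" q "n - k"] assms
  by (simp add: mult.assoc mult.commute mult.left_commute flip: power_add)

text \<open>After cancelling common factors, the \<open>k\<close>-th terms are related by
  \<open>(c - x) (1 - y z) = (y - x) (1 - c z) + (c - y) (1 - x z)\<close> at
  \<open>z = q^k\<close>.\<close>

lemma Phi_contig1:
  "(c - x) * (1 - y) * Phi q n x (y * q) e b d (c * q)
   = (y - x) * (1 - c * q ^ n) * Phi q n x y e b d c
     + (c - y) * (1 - x) * Phi q n (x * q) y e b d (c * q)"
proof -
  have "(c - x) * (1 - y) * term4 q n x (y * q) e b d (c * q) k
      = (y - x) * (1 - c * q ^ n) * term4 q n x y e b d c k
        + (c - y) * (1 - x) * term4 q n (x * q) y e b d (c * q) k" if "k \<le> n" for k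
  proof -
    define C where "C = q ^ k * qpoch_nat q (inverse q ^ n) k / qpoch_nat q q k * qpoch_nat q e k
     * qpoch_nat q (b * q ^ k) (n - k) * qpoch_nat q (d * q ^ k) (n - k)"
    define X where "X = qpoch_nat q x k"
    define Y where "Y = qpoch_nat q y k"
    have xq: "(1 - x) * qpoch_nat q (x * q) k = X * (1 - x * q ^ k)"
      and yq: "(1 - y) * qpoch_nat q (y * q) k = Y * (1 - y * q ^ k)"
      by (simp_all add: qpoch_nat_shift X_def Y_def)
    define E where "E = qpoch_nat q (c * q ^ k) (n - k)"
    define E' where "E' = qpoch_nat q (c * q * q ^ k) (n - k)"
    have main: "(c - x) * (1 - y * q ^ k) * E' = (y - x) * (1 - c * q ^ n) * E + (c - y) * (1 - x * q ^ k) * E'"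
    proof -
      have "(1 - c * q ^ n) * E = (1 - c * q ^ k) * E'"
        using qpoch_nat_lower_shift[OF that, of c q] by (simp add: E_def E'_def)
      moreover have "(c - x) * (1 - y * q ^ k) = (y - x) * (1 - c * q ^ k) + (c - y) * (1 - x * q ^ k)"
        by (simp add: algebra_simps)
      ultimately show ?thesis by (simp only: mult.assoc distrib_right)
    qed
    have "(c - x) * (1 - y) * term4 q n x (y * q) e b d (c * q) k
       = C * X * (c - x) * ((1 - y) * qpoch_nat q (y * q) k) * E'"
      by (simp add: term4_def C_def X_def E'_def mult_ac)
    also have "\<dots> = C * X * Y * ((c - x) * (1 - y * q ^ k) * E')"
      unfolding yq by (simp only: mult_ac)
    also have "\<dots> = C * X * Y * (y - x) * (1 - c * q ^ n) * E + C * Y * (c - y) * (X * (1 - x * q ^ k)) * E'"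
      unfolding main by (simp add: algebra_simps)
    also have "\<dots> = (y - x) * (1 - c * q ^ n) * term4 q n x y e b d c k
        + (c - y) * (1 - x) * term4 q n (x * q) y e b d (c * q) k"
      unfolding xq[symmetric]
      by (simp add: term4_def C_def X_def Y_def E_def E'_def mult_ac)
    finally show ?thesis .
  qed
  then show ?thesis
    by (simp add: Phi_def sum_distrib_left flip: sum.distrib)
qed

(* Only this relation needs the series to be balanced.  The combination of the k-th terms is
   U (k + 1) - U k for the quantity U of the proof. *)
lemma Phi_contig2:
  assumes q: "q \<noteq> 0" and nz: "b \<noteq> 0" "d \<noteq> 0" "x \<noteq> 0" and qn: "\<And>m. m \<ge> 1 \<Longrightarrow> q ^ m \<noteq> 1"
    and bal: "q * inverse q ^ n * x * y * e = b * c * d"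
  shows "(d - inverse q ^ n) * (1 - e / d) * (1 - x) * (1 - y) * Phi q n (x * q) (y * q) e b (d * q) (c * q)
     + (1 - x) * (1 - b / (q * x)) * (1 - c * q ^ n) * (1 - d * q ^ n) * Phi q n x y e b d c
     + (q * x * y / b - 1) * (inverse q ^ n * e / d - b / (q * x)) * (1 - x) * (1 - d * q ^ n)
         * Phi q n (x * q) y e b d (c * q) = 0"
proof -
  define A where "A = inverse q ^ n"
  have Aq: "A * q ^ n = 1" by (simp add: A_def q power_inverse)
  \<comment> \<open>The coefficients solve \<open>key\<close> below: \<open>z = 1/d\<close> leaves
    only \<alpha>, \<open>z = 1/x\<close> leaves only \<beta>, and comparing the terms linear in
    \<open>z\<close> gives \<gamma>, which factors once \<open>c\<close> is eliminated by
    balance.\<close>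
  define \<alpha> where "\<alpha> = (d - A) * (1 - e / d)"
  define \<beta> where "\<beta> = (1 - x) * (1 - b / (q * x))"
  define \<gamma> where "\<gamma> = (q * x * y / b - 1) * (A * e / d - b / (q * x))"
  have c: "c = q * A * x * y * e / (b * d)" using bal nz by (simp add: A_def field_simps)
  \<comment> \<open>The two products on the right have the same constant term and, by balance, the
    same coefficient of \<open>z^4\<close>; so their difference is \<open>z\<close> times a
    quadratic polynomial.\<close>
  have key: "z * (\<alpha> * (1 - x * z) * (1 - y * z) + \<beta> * (1 - c * z) * (1 - d * z) + \<gamma> * (1 - x * z) * (1 - d * z))
      = (1 - A * z) * (1 - x * z) * (1 - y * z) * (1 - e * z)
        - (1 - z) * (1 - b * z / q) * (1 - d * z) * (1 - c * z)" for z
    unfolding \<alpha>_def \<beta>_def \<gamma>_def c using nz q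
    by (simp add: divide_simps) algebra
  \<comment> \<open>The value 0 at \<open>k = 0\<close> stands for the factor
    \<open>1/(q;q)_(-1)\<close>. At \<open>k = n + 1\<close> the factor
    \<open>(q^(-n);q)_(n+1)\<close> vanishes, so the telescoping sum has no boundary terms.\<close>
  define U where "U k = (if k = 0 then 0 else
      qpoch_nat q A k * qpoch_nat q x k * qpoch_nat q y k * qpoch_nat q e k / qpoch_nat q q (k - 1)
      * qpoch_nat q (b * q ^ (k - 1)) (Suc n - k) * qpoch_nat q (d * q ^ k) (n - k) * qpoch_nat q (c * q ^ k) (n - k)
      * ((1 - c * q ^ n) * (1 - d * q ^ n)))" for k
  define S where "S k = \<alpha> * (1 - x) * (1 - y) * term4 q n (x * q) (y * q) e b (d * q) (c * q) k
     + \<beta> * (1 - c * q ^ n) * (1 - d * q ^ n) * term4 q n x y e b d c k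
     + \<gamma> * (1 - x) * (1 - d * q ^ n) * term4 q n (x * q) y e b d (c * q) k" for k
  have qpq: "qpoch_nat q q k \<noteq> 0" for k
    using qn by (force simp: qpoch_nat_def simp flip: power_Suc)
  \<comment> \<open>Rewrites \<open>U k\<close> over the denominator of the \<open>k\<close>-th
    terms, which exposes the factors of the second product in \<open>key\<close>.\<close>
  have U_rec: "U k * qpoch_nat q q k = qpoch_nat q A k * qpoch_nat q x k * qpoch_nat q y k * qpoch_nat q e k * (1 - q ^ k) * (1 - b * q ^ k / q)
      * qpoch_nat q (b * q ^ k) (n - k) * qpoch_nat q (d * q ^ k) (n - k) * qpoch_nat q (c * q ^ k) (n - k)
      * ((1 - c * q ^ n) * (1 - d * q ^ n))" if "k \<le> n" for k
  proof (cases k)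
    case 0
    then show ?thesis by (simp add: U_def)
  next
    case (Suc m)
    have "qpoch_nat q (b * q ^ m) (Suc (n - k)) = (1 - b * q ^ m) * qpoch_nat q (b * q ^ k) (n - k)"
      by (simp add: qpoch_nat_rec Suc mult_ac)
    moreover have "Suc n - k = Suc (n - k)" using that by simp
    moreover have "q ^ k / q = q ^ m" using q by (simp add: Suc)
    ultimately show ?thesis
      using qpq[of m] q by (simp add: U_def Suc qpoch_nat_Suc[of q q] mult_ac)
  qed
  have step: "S k = U (Suc k) - U k" if "k \<le> n" for k
  proof -
    define z where "z = q ^ k"
    define B where "B = qpoch_nat q A k * qpoch_nat q x k * qpoch_nat q y k * qpoch_nat q e k * qpoch_nat q (b * q ^ k) (n - k)"
    have z0: "z \<noteq> 0" using q by (simp add: z_def)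
    have xq: "(1 - x) * qpoch_nat q (x * q) k = qpoch_nat q x k * (1 - x * z)"
      and yq: "(1 - y) * qpoch_nat q (y * q) k = qpoch_nat q y k * (1 - y * z)"
      by (simp_all add: qpoch_nat_shift z_def)
    define D where "D = qpoch_nat q (d * q ^ k) (n - k)"
    define D' where "D' = qpoch_nat q (d * q * q ^ k) (n - k)"
    define E where "E = qpoch_nat q (c * q ^ k) (n - k)"
    define E' where "E' = qpoch_nat q (c * q * q ^ k) (n - k)"
    have 1: "(1 - x) * (1 - y) * term4 q n (x * q) (y * q) e b (d * q) (c * q) k * qpoch_nat q q k
        = z * B * (1 - x * z) * (1 - y * z) * D' * E'"
    proof -
      have "(1 - x) * (1 - y) * term4 q n (x * q) (y * q) e b (d * q) (c * q) k * qpoch_nat q q k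
        = z * qpoch_nat q A k * ((1 - x) * qpoch_nat q (x * q) k) * ((1 - y) * qpoch_nat q (y * q) k) * qpoch_nat q e k * qpoch_nat q (b * q ^ k) (n - k) * D' * E'"
        using qpq[of k] by (simp add: term4_def D'_def E'_def z_def A_def mult_ac)
      then show ?thesis unfolding xq yq by (simp add: B_def mult_ac)
    qed
    have 2: "term4 q n x y e b d c k * qpoch_nat q q k = z * B * D * E"
      using qpq[of k] by (simp add: term4_def D_def E_def z_def A_def B_def mult_ac)
    have 3: "(1 - x) * term4 q n (x * q) y e b d (c * q) k * qpoch_nat q q k = z * B * (1 - x * z) * D * E'"
    proof -
      have "(1 - x) * term4 q n (x * q) y e b d (c * q) k * qpoch_nat q q k
        = z * qpoch_nat q A k * ((1 - x) * qpoch_nat q (x * q) k) * qpoch_nat q y k * qpoch_nat q e k * qpoch_nat q (b * q ^ k) (n - k) * D * E'"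
        using qpq[of k] by (simp add: term4_def D_def E'_def z_def A_def mult_ac)
      then show ?thesis unfolding xq by (simp add: B_def mult_ac)
    qed
    have lc: "(1 - c * z) * E' = (1 - c * q ^ n) * E"
      using qpoch_nat_lower_shift[OF that, of c q] by (simp add: E_def E'_def z_def)
    have ld: "(1 - d * z) * D' = (1 - d * q ^ n) * D"
      using qpoch_nat_lower_shift[OF that, of d q] by (simp add: D_def D'_def z_def)
    have "S k * qpoch_nat q q k = \<alpha> * ((1 - x) * (1 - y) * term4 q n (x * q) (y * q) e b (d * q) (c * q) k * qpoch_nat q q k)
       + \<beta> * (1 - c * q ^ n) * (1 - d * q ^ n) * (term4 q n x y e b d c k * qpoch_nat q q k)
       + \<gamma> * (1 - d * q ^ n) * ((1 - x) * term4 q n (x * q) y e b d (c * q) k * qpoch_nat q q k)"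
      by (simp add: S_def algebra_simps)
    also have "\<dots> = z * B * (\<alpha> * (1 - x * z) * (1 - y * z) * D' * E'
       + \<beta> * ((1 - c * q ^ n) * E) * ((1 - d * q ^ n) * D)
       + \<gamma> * (1 - x * z) * ((1 - d * q ^ n) * D) * E')"
      unfolding 1 2 3 by (simp add: algebra_simps)
    also have "\<dots> = B * D' * E' * (z * (\<alpha> * (1 - x * z) * (1 - y * z) + \<beta> * (1 - c * z) * (1 - d * z)
        + \<gamma> * (1 - x * z) * (1 - d * z)))"
      unfolding lc[symmetric] ld[symmetric] by (simp add: algebra_simps)
    also have "\<dots> = B * D' * E' * ((1 - A * z) * (1 - x * z) * (1 - y * z) * (1 - e * z))
        - B * (1 - z) * (1 - b * z / q) * ((1 - d * z) * D') * ((1 - c * z) * E')"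
      unfolding key by (simp add: algebra_simps)
    also have "B * (1 - z) * (1 - b * z / q) * ((1 - d * z) * D') * ((1 - c * z) * E') = U k * qpoch_nat q q k"
      unfolding U_rec[OF that] lc ld by (simp add: B_def D_def E_def z_def mult_ac)
    also have "B * D' * E' * ((1 - A * z) * (1 - x * z) * (1 - y * z) * (1 - e * z)) = U (Suc k) * qpoch_nat q q k"
    \<comment> \<open>At \<open>k = n\<close> both sides vanish through \<open>1 - A q^n\<close>;
      for smaller \<open>k\<close> one factor can be split off the symbols of length
      \<open>n - k\<close>.\<close>
    proof (cases "k = n")
      case True
      then show ?thesis using Aq by (simp add: z_def U_def qpoch_nat_Suc)
    next
      case False
      define m where "m = n - Suc k"
      have m: "n - k = Suc m" and n: "n = k + Suc m" using that False by (auto simp: m_def)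
      have "D' = qpoch_nat q (d * q ^ Suc k) m * (1 - d * q ^ n)" "E' = qpoch_nat q (c * q ^ Suc k) m * (1 - c * q ^ n)"
        unfolding D'_def E'_def m qpoch_nat_Suc by (simp_all add: n mult_ac power_add)
      then show ?thesis
        using qpq[of k] by (simp add: U_def B_def z_def qpoch_nat_Suc m_def[symmetric] mult_ac)
    qed
    finally have "S k * qpoch_nat q q k = (U (Suc k) - U k) * qpoch_nat q q k"
      by (simp add: algebra_simps)
    then show ?thesis using qpq[of k] by simp
  qed
  have "(\<Sum>k\<le>n. S k) = (\<Sum>k\<le>n. U (Suc k) - U k)"
    using step by simp
  also have "\<dots> = U (Suc n) - U 0"
    by (simp add: sum_lessThan_telescope flip: lessThan_Suc_atMost)
  also have "\<dots> = 0" using Aq by (simp add: U_def qpoch_nat_Suc)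
  finally show ?thesis
    by (simp add: S_def Phi_def sum.distrib sum_distrib_left \<alpha>_def \<beta>_def \<gamma>_def A_def)
qed

(* Accounts for the terms with j1 - 1 = -1 in the recurrences below. *)
lemma Phi_eq_0:
  assumes "q \<noteq> 0" and "m < n" and x: "x = inverse q ^ m"
  shows "Phi q n x y e b x c = 0"
  unfolding Phi_def
proof (rule sum.neutral, rule ballI)
  fix k assume "k \<in> {..n}"
  show "term4 q n x y e b x c k = 0"
  \<comment> \<open>The parameter \<open>q^(-m)\<close> occurs both above and below: for
    \<open>k\<close> up to \<open>m\<close> its lower symbol contains a zero factor, beyond that its
    upper symbol does.\<close>
  proof (cases "k \<le> m")
    case True
    have "inverse q ^ m * q ^ k * q ^ (m - k) = 1"
      using True assms by (simp add: mult.assoc power_inverse flip: power_add)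
    moreover have "m - k < n - k" using True assms by simp
    ultimately have "qpoch_nat q (x * q ^ k) (n - k) = 0"
      by (auto simp: qpoch_nat_def x intro!: bexI[of _ "m - k"])
    then show ?thesis by (simp add: term4_def)
  next
    case False
    have "inverse q ^ m * q ^ m = 1" using assms by (simp add: power_inverse)
    then have "qpoch_nat q x k = 0"
      using False by (auto simp: qpoch_nat_def x intro!: bexI[of _ m])
    then show ?thesis by (simp add: term4_def)
  qed
qed

section \<open>The fused weight as prefactor times series, and its two recurrences\<close>

section \<open>Recurrences for the fused weights\<close>

lemma qpoch_int: "qpoch x q (int n) = qpoch_nat q x n"
  unfolding qpoch_def qpoch_nat_def
  by (auto intro!: prod.reindex_bij_witness[of _ int nat] simp: power_int_def)

text \<open>For negative \<open>n\<close> the step removes a factor from an inverted product, so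
  that factor must be nonzero.\<close>

lemma qpoch_add_1:
  assumes "n < 0 \<Longrightarrow> 1 - q powi n * x \<noteq> 0"
  shows "qpoch x q (n + 1) = qpoch x q n * (1 - x * q powi n)"
proof (cases "n \<ge> 0")
  case True
  then have "{0..<n + 1} = insert n {0..<n}" by auto
  with True show ?thesis by (simp add: qpoch_def mult.commute)
next
  case False
  then have "{n..<0} = insert n {n + 1..<0}" by auto
  with False assms show ?thesis by (auto simp: qpoch_def mult.commute)
qed

context
  fixes q q4 s v :: complex
  assumes q4: "q4 ^ 4 = q"
    and q0: "q \<noteq> 0" and q1: "\<And>n::nat. n \<ge> 1 \<Longrightarrow> q ^ n \<noteq> 1"
    and s0: "s \<noteq> 0" and v0: "v \<noteq> 0"
    and vs: "\<And>n::nat. 1 - q ^ n * (v * s) \<noteq> 0"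
    and v_s: "\<And>n::nat. n \<ge> 1 \<Longrightarrow> 1 - q powi (- int n) * (v * inverse s) \<noteq> 0"
begin

text \<open>Independent of \<open>J\<close>: passing to \<open>J + 1\<close> only replaces
  \<open>y\<close> by \<open>y * q\<close> and \<open>c\<close> by \<open>c * q\<close> in the
  series.\<close>

definition fused_prefactor :: "nat \<Rightarrow> nat \<Rightarrow> nat \<Rightarrow> nat \<Rightarrow> complex" where
  "fused_prefactor i1 j1 i2 j2 = (-1) ^ (i1 + j1)
        * q4 powi ((int i1)\<^sup>2 + (int i2)\<^sup>2 + 2 * (int i1 * (int j1 - 1) + int i2 * int j2))
        * s powi (int j1 - int i1) * v ^ i1
        * qpoch (v * inverse s) q (int j1 - int i2)
        / (qpoch_nat q q i1 * qpoch_nat q (v * s) (i1 + j1))"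

lemma fused_weight_eq_Phi:
  assumes "i1 + j1 = i2 + j2"
  shows "fused_weight q4 q s J v i1 j1 i2 j2 = fused_prefactor i1 j1 i2 j2 *
     Phi q i1 (inverse q ^ i2) (q ^ J * s * v) (q * s * inverse v) (s\<^sup>2)
       (q * q powi (int j1 - int i2)) (q ^ J * q / q ^ (i1 + j1))"
proof -
  have "phi_bar i1
            [q powi (- int i2), q ^ J * s * v, q * s * inverse v]
            [s\<^sup>2, q powi (1 + int j1 - int i2), q powi (1 + int J - int i1 - int j1)]
            q q = Phi q i1 (inverse q ^ i2) (q ^ J * s * v) (q * s * inverse v) (s\<^sup>2)
       (q * q powi (int j1 - int i2)) (q ^ J * q / q ^ (i1 + j1))"
  proof -
    have 1: "q powi (- int i) = inverse q ^ i" for i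
      by (simp add: power_int_minus power_inverse)
    have 2: "q powi (1 + int j1 - int i2) = q * q powi (int j1 - int i2)"
      using q0 power_int_add[of q 1 "int j1 - int i2"] by (simp add: algebra_simps)
    have "1 + int J - int i1 - int j1 = int (Suc J) - int (i1 + j1)" by simp
    then have 3: "q powi (1 + int J - int i1 - int j1) = q ^ J * q / q ^ (i1 + j1)"
      using q0 power_int_diff[of q "int (Suc J)" "int (i1 + j1)"] by (simp only: power_int_of_nat) simp
    show ?thesis
      unfolding phi_bar_def Phi_def 1 2 3 term4_def qpoch_int
      by (simp add: atLeast0AtMost lessThan_Suc eval_nat_numeral mult_ac)
  qed
  moreover have "qpoch (v * s) q (int i1 + int j1) = qpoch_nat q (v * s) (i1 + j1)"
    using qpoch_int[of "v * s" q "i1 + j1"] by simp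
  ultimately show ?thesis
    using assms unfolding fused_weight_def fused_prefactor_def qpoch_int by (simp only: if_True refl)
qed

lemma q_powi_add: "q powi (m + n) = q powi m * q powi n"
  by (simp add: power_int_add q0)

lemma q4_0: "q4 \<noteq> 0"
  using q4 q0 by auto

lemma q_power_q4: "q ^ n = q4 powi (4 * int n)"
  using q4_0 power_int_of_nat[of q4 "4 * n"] by (simp add: power_mult flip: q4)

(* The relative weights p_0 and p_1 with which j paths leaving a column of J + 1 rows are distributed
   with 0 or 1 of them in the top row, in the gauge of the fused weight. *)
definition split0 :: "nat \<Rightarrow> nat \<Rightarrow> complex" where
  "split0 J j = 1 - q ^ J * q / q ^ j"

definition split1 :: "nat \<Rightarrow> nat \<Rightarrow> complex" where
  "split1 J j = - s * q ^ J * q4 powi (3 - 2 * int j)"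

lemma qp_vs: "qpoch_nat q (v * s) n \<noteq> 0"
  using vs by (auto simp: qpoch_nat_def mult_ac)

lemma qp_qq: "qpoch_nat q q n \<noteq> 0"
  using q1 by (force simp: qpoch_nat_def simp flip: power_Suc)

text \<open>The exponent of \<open>q4\<close> is quadratic in the state, so its change is linear;
  the exponent in \<open>split1\<close> and conservation turn it into an integral power of
  \<open>q\<close>.\<close>

lemma fused_prefactor_Suc_Suc:
  "split1 J (Suc j1) * fused_prefactor i1 j1 i2 j2
   = fused_prefactor i1 (Suc j1) (Suc i2) j2 * (q ^ J * q / q ^ (i1 + Suc j1)) * (1 - v * s * q ^ (i1 + j1))"
  if "i1 + j1 = i2 + j2"
proof -
  define N where "N = i1 + j1"
  have e: "q4 powi (3 - 2 * int (Suc j1)) * q4 powi ((int i1)\<^sup>2 + (int i2)\<^sup>2 + 2 * (int i1 * (int j1 - 1) + int i2 * int j2))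
     = q4 powi ((int i1)\<^sup>2 + (int (Suc i2))\<^sup>2 + 2 * (int i1 * (int (Suc j1) - 1) + int (Suc i2) * int j2)) * (1 / q ^ N)"
    (is "?a * ?b = ?c * _")
  proof -
    have i2: "int i2 = int i1 + int j1 - int j2" using that by linarith
    have "?a * ?b * q4 powi (4 * int N) = ?c"
      unfolding of_nat_Suc i2 using q4_0
      by (simp add: N_def power2_eq_square algebra_simps flip: power_int_add)
    then show ?thesis
      using q4_0 by (simp add: q_power_q4 field_simps)
  qed
  have sp: "s powi (int (Suc j1) - int i1) = s * s powi (int j1 - int i1)"
    using s0 power_int_add[of s 1 "int j1 - int i1"] by (simp add: algebra_simps)
  have qv: "qpoch_nat q (v * s) (i1 + Suc j1) = qpoch_nat q (v * s) N * (1 - v * s * q ^ N)"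
    by (simp add: N_def qpoch_nat_Suc)
  define C where "C = (-1) ^ N * s powi (int j1 - int i1) * v ^ i1
      * qpoch (v * inverse s) q (int j1 - int i2) / (qpoch_nat q q i1 * qpoch_nat q (v * s) N)"
  have "split1 J (Suc j1) * fused_prefactor i1 j1 i2 j2 = - s * q ^ J * C * (?a * ?b)"
    by (simp add: split1_def fused_prefactor_def C_def N_def mult_ac)
  also have "\<dots> = - s * q ^ J * C * (?c * (1 / q ^ N))"
    by (simp only: e)
  also have "\<dots> = (- s * C * ?c) * (q ^ J * q / q ^ (i1 + Suc j1))"
    using q0 by (simp add: N_def field_simps)
  also have "- s * C * ?c = fused_prefactor i1 (Suc j1) (Suc i2) j2 * (1 - v * s * q ^ N)"
    unfolding fused_prefactor_def sp qv C_def using vs[of N] by (simp add: mult_ac N_def)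
  finally show ?thesis by (simp add: N_def mult_ac)
qed

text \<open>Lowering the index of the symbol in \<open>v/s\<close> by one produces the last factor,
  which is the \<open>1 - e / d\<close> of \<open>Phi_contig2\<close>.\<close>

lemma fused_prefactor_shift:
  assumes "i1 + j1 = i2 + Suc j2"
  shows "split1 J (Suc j2) * fused_prefactor i1 j1 i2 (Suc j2)
   = fused_prefactor i1 j1 (Suc i2) j2 * (q ^ J * v * inverse q ^ i1)
     * (1 - q * s * inverse v / q powi (int j1 - int i2))"
proof -
  define m where "m = int j1 - int i2"
  have e: "q4 powi (3 - 2 * int (Suc j2)) * q4 powi ((int i1)\<^sup>2 + (int i2)\<^sup>2 + 2 * (int i1 * (int j1 - 1) + int i2 * int (Suc j2)))
     = q4 powi ((int i1)\<^sup>2 + (int (Suc i2))\<^sup>2 + 2 * (int i1 * (int j1 - 1) + int (Suc i2) * int j2)) * (1 / q ^ j2)"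
    (is "?a * ?b = ?c * _")
  proof -
    have "?a * ?b * q4 powi (4 * int j2) = ?c"
      using q4_0
      by (simp add: power2_eq_square algebra_simps flip: power_int_add)
    then show ?thesis
      using q4_0 by (simp add: q_power_q4 field_simps)
  qed
  have nz: "1 - q powi (m - 1) * (v * inverse s) \<noteq> 0" if "m - 1 < 0"
    using v_s[of "nat (1 - m)"] that by simp
  have "m - 1 + 1 = m" by simp
  then have qv: "qpoch (v * inverse s) q m = qpoch (v * inverse s) q (m - 1) * (1 - v * inverse s * q powi (m - 1))"
    using qpoch_add_1[of "m - 1" q "v * inverse s"] nz by metis
  have qm: "q powi m \<noteq> 0" using q0 by simp
  have qm1: "q powi (m - 1) = q powi m / q" using q0 by (simp add: power_int_diff)
  have qj: "q ^ Suc j2 = q ^ i1 * q powi m"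
  proof -
    have "int (Suc j2) = int i1 + m" using assms by (simp add: m_def)
    then have "q powi int (Suc j2) = q powi (int i1) * q powi m"
      by (simp only: q_powi_add)
    then show ?thesis by (simp only: power_int_of_nat)
  qed
  define C where "C = (-1) ^ (i1 + j1) * s powi (int j1 - int i1) * v ^ i1
      * qpoch (v * inverse s) q (m - 1) / (qpoch_nat q q i1 * qpoch_nat q (v * s) (i1 + j1))"
  have "split1 J (Suc j2) * fused_prefactor i1 j1 i2 (Suc j2)
     = - s * q ^ J * (C * (1 - v * inverse s * q powi (m - 1))) * (?a * ?b)"
    by (simp add: split1_def fused_prefactor_def C_def m_def[symmetric] qv mult_ac)
  also have "\<dots> = - s * q ^ J * (C * (1 - v * inverse s * q powi (m - 1))) * (?c * (1 / q ^ j2))"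
    by (simp only: e)
  also have "\<dots> = C * ?c * (- s * q ^ J * (1 - v * inverse s * q powi (m - 1)) / q ^ j2)"
    by (simp add: mult_ac)
  also have "- s * q ^ J * (1 - v * inverse s * q powi (m - 1)) / q ^ j2
     = q ^ J * v * inverse q ^ i1 * (1 - q * s * inverse v / q powi m)"
  proof -
    have qj2: "q ^ j2 = q ^ i1 * q powi m / q" using qj q0 by (simp add: field_simps)
    show ?thesis
      unfolding qm1 qj2 using q0 s0 v0 qm by (simp add: field_simps)
  qed
  also have "C * ?c = fused_prefactor i1 j1 (Suc i2) j2"
  proof -
    have "int j1 - int (Suc i2) = m - 1" by (simp add: m_def)
    then show ?thesis by (simp add: fused_prefactor_def C_def mult_ac del: of_nat_Suc)
  qed
  finally show ?thesis by (simp add: m_def mult_ac)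
qed

abbreviation (input) "Fw J \<equiv> fused_weight q4 q s J v"

text \<open>This is \<open>Phi_contig1\<close> multiplied by \<open>- q^i2\<close>: lowering
  \<open>j1\<close> and \<open>i2\<close> together keeps \<open>d\<close> and turns
  \<open>x\<close>, \<open>c\<close> into \<open>x * q\<close>, \<open>c * q\<close>.\<close>

lemma fused_weight_rec0:
  assumes cons: "i1 + j1 = i2 + j2"
  shows "split0 J j2 * (1 - s * (q ^ J * v)) * Fw (Suc J) i1 j1 i2 j2
   = split0 J j1 * (1 - s * q ^ i2 * (q ^ J * v)) * Fw J i1 j1 i2 j2
     + (if j1 = 0 \<or> i2 = 0 then 0
        else split1 J j1 * (1 - q ^ i2) * Fw J i1 (j1 - 1) (i2 - 1) j2)"
proof -
  define x where "x = inverse q ^ i2"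
  define y where "y = q ^ J * s * v"
  define e where "e = q * s * inverse v"
  define d where "d = q * q powi (int j1 - int i2)"
  define c where "c = q ^ J * q / q ^ (i1 + j1)"
  define X where "X = fused_prefactor i1 j1 i2 j2"
  have W1: "Fw (Suc J) i1 j1 i2 j2 = X * Phi q i1 x (y * q) e (s\<^sup>2) d (c * q)"
    unfolding fused_weight_eq_Phi[OF cons] X_def x_def y_def e_def d_def c_def
    by (simp add: mult_ac)
  have W2: "Fw J i1 j1 i2 j2 = X * Phi q i1 x y e (s\<^sup>2) d c"
    unfolding fused_weight_eq_Phi[OF cons] X_def x_def y_def e_def d_def c_def ..
  have xq: "x * q ^ i2 = 1" using q0 by (simp add: x_def power_inverse)
  have cq: "c * q ^ i1 = q ^ J * q / q ^ j1"
    unfolding c_def using q0 by (simp add: power_add field_simps)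
  have cq2: "c * q ^ i2 = q ^ J * q / q ^ j2"
    unfolding c_def cons using q0 by (simp add: power_add field_simps)
  \<comment> \<open>The formula also covers the missing states: the factor \<open>1 - q^i2\<close>
    vanishes for \<open>i2 = 0\<close>, and the series vanishes for \<open>j1 = 0\<close> with
    \<open>i2 > 0\<close>.\<close>
  have third: "(if j1 = 0 \<or> i2 = 0 then 0
        else split1 J j1 * (1 - q ^ i2) * Fw J i1 (j1 - 1) (i2 - 1) j2)
      = X * (c - y) * (1 - q ^ i2) * Phi q i1 (x * q) y e (s\<^sup>2) d (c * q)"
  proof (cases "i2 = 0")
    case False
    then obtain i where i: "i2 = Suc i" by (cases i2) auto
    have xi: "x * q = inverse q ^ i" using q0 by (simp add: x_def i)
    show ?thesis
    proof (cases j1)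
      case 0
      have "d = inverse q ^ i"
        unfolding d_def 0 i using q0 power_int_add[of q 1 "- int i - 1"]
        by (simp add: power_int_minus power_int_diff inverse_eq_divide power_one_over)
      moreover have "i < i1" using cons i 0 by simp
      ultimately show ?thesis
        using Phi_eq_0[of q i i1 "x * q" y e "s\<^sup>2" "c * q"] q0 xi 0 by simp
    next
      case (Suc j)
      have cons': "i1 + j = i + j2" using cons i Suc by simp
      have "Fw J i1 j i j2 = fused_prefactor i1 j i j2 * Phi q i1 (x * q) y e (s\<^sup>2) d (c * q)"
      proof -
        have "q ^ J * q / q ^ (i1 + j) = c * q" using q0 by (simp add: c_def Suc)
        moreover have "q * q powi (int j - int i) = d" by (simp add: d_def Suc i)
        ultimately show ?thesis
          unfolding fused_weight_eq_Phi[OF cons'] xi y_def e_def by simp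
      qed
      moreover have "split1 J j1 * fused_prefactor i1 j i j2 = X * (c - y)"
        unfolding Suc fused_prefactor_Suc_Suc[OF cons'] unfolding X_def c_def y_def i Suc
        using q0 by (simp add: field_simps)
      ultimately show ?thesis using Suc i by (simp add: mult_ac)
    qed
  qed simp
  have split0': "split0 J j2 = - (q ^ i2) * (c - x)"
    unfolding split0_def cq2[symmetric] using xq by (simp add: algebra_simps)
  have "split0 J j2 * (1 - y) * Phi q i1 x (y * q) e (s\<^sup>2) d (c * q)
      = - (q ^ i2) * ((c - x) * (1 - y) * Phi q i1 x (y * q) e (s\<^sup>2) d (c * q))"
    unfolding split0' by (simp only: mult.assoc)
  also have "\<dots> = (- (q ^ i2) * (y - x)) * (1 - c * q ^ i1) * Phi q i1 x y e (s\<^sup>2) d c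
      + (c - y) * (- (q ^ i2) * (1 - x)) * Phi q i1 (x * q) y e (s\<^sup>2) d (c * q)"
    unfolding Phi_contig1 by (simp only: distrib_left mult_ac)
  also have "- (q ^ i2) * (y - x) = 1 - y * q ^ i2" using xq by (simp add: algebra_simps)
  also have "- (q ^ i2) * (1 - x) = 1 - q ^ i2" using xq by (simp add: algebra_simps)
  finally have main: "split0 J j2 * (1 - y) * Phi q i1 x (y * q) e (s\<^sup>2) d (c * q)
     = (1 - y * q ^ i2) * split0 J j1 * Phi q i1 x y e (s\<^sup>2) d c
       + (c - y) * (1 - q ^ i2) * Phi q i1 (x * q) y e (s\<^sup>2) d (c * q)"
    unfolding cq by (simp add: split0_def)
  have "split0 J j2 * (1 - y) * (X * Phi q i1 x (y * q) e (s\<^sup>2) d (c * q))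
     = X * (split0 J j2 * (1 - y) * Phi q i1 x (y * q) e (s\<^sup>2) d (c * q))"
    by (simp only: mult_ac)
  also have "\<dots> = split0 J j1 * (1 - y * q ^ i2) * (X * Phi q i1 x y e (s\<^sup>2) d c)
       + X * (c - y) * (1 - q ^ i2) * Phi q i1 (x * q) y e (s\<^sup>2) d (c * q)"
    unfolding main by (simp only: distrib_left mult_ac)
  finally show ?thesis
    unfolding W1 W2 third by (simp add: y_def mult_ac)
qed

text \<open>This is \<open>Phi_contig2\<close> based at the state
  \<open>(i1, j1; Suc i2, j2)\<close>, whence \<open>Suc i2\<close> in \<open>x\<close>. Lowering
  \<open>i2\<close> turns \<open>x\<close>, \<open>d\<close> into \<open>x * q\<close>,
  \<open>d * q\<close>; lowering \<open>j1\<close> as well restores \<open>d\<close> and turns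
  \<open>c\<close> into \<open>c * q\<close>.\<close>

lemma fused_weight_rec1:
  assumes cons: "i1 + j1 = i2 + Suc j2"
  shows "split1 J (Suc j2) * (1 - s * (q ^ J * v)) * Fw (Suc J) i1 j1 i2 (Suc j2)
   = split0 J j1 * ((1 - s\<^sup>2 * q ^ i2) * (q ^ J * v)) * Fw J i1 j1 (Suc i2) j2
     + (if j1 = 0 then 0
        else split1 J j1 * (q ^ J * v - s * q ^ i2) * Fw J i1 (j1 - 1) i2 j2)"
proof -
  define x where "x = inverse q ^ Suc i2"
  define y where "y = q ^ J * s * v"
  define e where "e = q * s * inverse v"
  define d where "d = q powi (int j1 - int i2)"
  define c where "c = q ^ J * q / q ^ (i1 + j1)"
  define X where "X = fused_prefactor i1 j1 (Suc i2) j2"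
  define u where "u = q ^ J * v"
  define \<gamma> where "\<gamma> = (q * x * y / s\<^sup>2 - 1) * (inverse q ^ i1 * e / d - s\<^sup>2 / (q * x))"
  let ?\<Phi>1 = "Phi q i1 (x * q) (y * q) e (s\<^sup>2) (d * q) (c * q)"
  let ?\<Phi>2 = "Phi q i1 x y e (s\<^sup>2) d c"
  let ?\<Phi>3 = "Phi q i1 (x * q) y e (s\<^sup>2) d (c * q)"
  have cons2: "i1 + j1 = Suc i2 + j2" using cons by simp
  have x0: "x \<noteq> 0" and d0: "d \<noteq> 0" using q0 by (simp_all add: x_def d_def)
  have xi: "x * q = inverse q ^ i2" using q0 by (simp add: x_def)
  have xq: "q * x * q ^ i2 = 1" using q0 by (simp add: x_def power_inverse field_simps)
  have de: "d = q ^ j1 / q ^ i2" using q0 by (simp add: d_def power_int_diff)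
  have xe: "x = 1 / (q * q ^ i2)" by (simp add: x_def power_inverse field_simps)
  have gx: "s\<^sup>2 / (q * x) = s\<^sup>2 * q ^ i2" using q0 by (simp add: xe)
  have W1: "Fw (Suc J) i1 j1 i2 (Suc j2) = fused_prefactor i1 j1 i2 (Suc j2) * ?\<Phi>1"
    unfolding fused_weight_eq_Phi[OF cons] xi y_def e_def d_def c_def
    by (simp add: mult_ac)
  have "q * q powi (int j1 - int (Suc i2)) = d"
    using power_int_add[of q 1 "int j1 - int (Suc i2)"] q0 by (simp add: d_def)
  then have W2: "Fw J i1 j1 (Suc i2) j2 = X * ?\<Phi>2"
    unfolding fused_weight_eq_Phi[OF cons2] X_def x_def y_def e_def c_def by simp
  have dq: "d * q ^ i1 = q ^ Suc j2"
  proof -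
    have "int (Suc j2) = (int j1 - int i2) + int i1" using cons by linarith
    then have "q powi int (Suc j2) = d * q powi int i1"
      unfolding d_def by (simp only: q_powi_add)
    then show ?thesis by (simp only: power_int_of_nat)
  qed
  have cq: "c * q ^ i1 = q ^ J * q / q ^ j1"
    unfolding c_def using q0 by (simp add: power_add field_simps)
  have xy: "q * x * y / s\<^sup>2 = u / (s * q ^ i2)"
    using s0 q0 by (simp add: xe y_def u_def power2_eq_square)
  have qj2: "q ^ Suc j2 \<noteq> 1" by (rule q1) simp
  have \<gamma>: "\<gamma> = (u - s * q ^ i2) * (q / q ^ (i1 + j1)) * (1 - v * s * q ^ (i1 + j1) / q) / v"
  proof -
    have Ai: "inverse q ^ i1 / d = q ^ i2 / q ^ (i1 + j1)"
      unfolding de using q0 by (simp add: power_inverse field_simps power_add)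
    have h: "inverse q ^ i1 * e / d = q ^ i2 / q ^ (i1 + j1) * e" by (simp flip: Ai)
    show ?thesis
      unfolding \<gamma>_def xy gx h unfolding e_def using q0 s0 v0 by (simp add: field_simps power2_eq_square)
  qed
  have third: "(if j1 = 0 then 0 else split1 J j1 * (u - s * q ^ i2) * Fw J i1 (j1 - 1) i2 j2)
      = X * u * \<gamma> * ?\<Phi>3"
  proof (cases j1)
    case 0
    have "d = inverse q ^ i2"
      by (simp add: d_def 0 power_int_minus power_inverse)
    moreover have "i2 < i1" using cons 0 by simp
    ultimately show ?thesis
      using Phi_eq_0[of q i2 i1 "x * q" y e "s\<^sup>2" "c * q"] q0 xi 0 by simp
  next
    case (Suc j)
    have cons': "i1 + j = i2 + j2" using cons Suc by simp
    have "Fw J i1 j i2 j2 = fused_prefactor i1 j i2 j2 * ?\<Phi>3"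
    proof -
      have "q ^ J * q / q ^ (i1 + j) = c * q" using q0 by (simp add: c_def Suc)
      moreover have "q * q powi (int j - int i2) = d"
        using power_int_add[of q 1 "int j - int i2"] q0 by (simp add: d_def Suc algebra_simps)
      ultimately show ?thesis
        unfolding fused_weight_eq_Phi[OF cons'] xi y_def e_def by simp
    qed
    moreover have "split1 J j1 * fused_prefactor i1 j i2 j2 * (u - s * q ^ i2) = X * u * \<gamma>"
      unfolding Suc fused_prefactor_Suc_Suc[OF cons'] \<gamma> unfolding X_def Suc u_def
      using q0 v0 by (simp add: field_simps)
    ultimately show ?thesis using Suc by (simp add: mult_ac)
  qed
  have bal: "q * inverse q ^ i1 * x * y * e = s\<^sup>2 * c * d"
    unfolding xe y_def e_def c_def de power_inverse using q0 v0
    by (simp add: field_simps power_add power2_eq_square)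
  have x1: "1 - x \<noteq> 0"
    using q1[of "Suc i2"] q0 unfolding x_def power_inverse
    by (metis eq_iff_diff_eq_0 inverse_eq_1_iff le_add1 plus_1_eq_Suc)
  \<comment> \<open>Gives all three terms of \<open>Phi_contig2\<close> the common factor
    \<open>(1 - x) (1 - d q^i1)\<close>. It is nonzero, as \<open>x = q^(-i2-1)\<close> and
    \<open>d q^i1 = q^(j2+1)\<close>.\<close>
  have dA: "d - inverse q ^ i1 = - (inverse q ^ i1) * (1 - d * q ^ i1)"
    using q0 by (simp add: algebra_simps power_inverse)
  have "(1 - x) * (1 - d * q ^ i1) *
      (- (inverse q ^ i1) * (1 - e / d) * (1 - y) * ?\<Phi>1
       + (1 - s\<^sup>2 / (q * x)) * (1 - c * q ^ i1) * ?\<Phi>2 + \<gamma> * ?\<Phi>3) = 0"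
    using Phi_contig2[OF q0 _ d0 x0 q1 bal] s0 unfolding dA \<gamma>_def[symmetric]
    by (simp only: distrib_left mult_ac power_not_zero not_False_eq_True simp_thms power_eq_0_iff)
  then have "- (inverse q ^ i1) * (1 - e / d) * (1 - y) * ?\<Phi>1
       + (1 - s\<^sup>2 / (q * x)) * (1 - c * q ^ i1) * ?\<Phi>2 + \<gamma> * ?\<Phi>3 = 0"
    using x1 qj2 unfolding dq by simp
  then have main: "inverse q ^ i1 * (1 - e / d) * (1 - y) * ?\<Phi>1
       = (1 - s\<^sup>2 * q ^ i2) * split0 J j1 * ?\<Phi>2 + \<gamma> * ?\<Phi>3"
    unfolding cq gx by (simp add: split0_def algebra_simps)
  have pX: "split1 J (Suc j2) * fused_prefactor i1 j1 i2 (Suc j2) = X * u * inverse q ^ i1 * (1 - e / d)"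
    unfolding fused_prefactor_shift[OF cons] X_def u_def e_def d_def by (simp only: mult_ac)
  have "split1 J (Suc j2) * (1 - y) * (fused_prefactor i1 j1 i2 (Suc j2) * ?\<Phi>1)
     = (split1 J (Suc j2) * fused_prefactor i1 j1 i2 (Suc j2)) * (1 - y) * ?\<Phi>1"
    by (simp only: mult_ac)
  also have "\<dots> = X * u * (inverse q ^ i1 * (1 - e / d) * (1 - y) * ?\<Phi>1)"
    unfolding pX by (simp only: mult_ac)
  also have "\<dots> = split0 J j1 * ((1 - s\<^sup>2 * q ^ i2) * u) * (X * ?\<Phi>2) + X * u * \<gamma> * ?\<Phi>3"
    unfolding main by (simp only: distrib_left mult_ac)
  finally show ?thesis
    unfolding W1 W2 third[unfolded u_def] by (simp add: y_def u_def mult_ac)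
qed

section \<open>The starting point \<open>J = 0\<close>\<close>

lemma term4_eq_0:
  assumes "k < n"
  shows "term4 q n x y e b d (q / q ^ n) k = 0"
proof -
  \<comment> \<open>For \<open>c = q^(1-n)\<close> the lower symbol \<open>(c q^k;q)_(n-k)\<close>
    ends with the factor \<open>1 - q^0\<close>; only the term \<open>k = n\<close> can
    survive.\<close>
  obtain m where n: "n = Suc (k + m)" using assms less_imp_Suc_add by blast
  have "q / q ^ n * q ^ k * q ^ m = 1" using q0 by (simp add: n power_add)
  moreover have "n - k = Suc m" using n by simp
  ultimately have "qpoch_nat q (q / q ^ n * q ^ k) (n - k) = 0" by (simp only: qpoch_nat_Suc) simp
  then show ?thesis by (simp add: term4_def)
qed

text \<open>Only the last term of the series remains, and its \<open>(sv;q)_i\<close> cancels the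
  prefactor's. The quotient \<open>h\<close> occurs twice since both \<open>q^(-i1)\<close> and
  \<open>q^(-i2)\<close> are \<open>q^(-i)\<close>; \<open>f\<close> pairs the symbols in
  \<open>q s / v\<close> and \<open>v / s\<close>, which invert each other up to a monomial.\<close>

lemma fused_weight_0_eq_1: "Fw 0 i 0 i 0 = 1"
proof -
  define h where "h i = qpoch_nat q (inverse q ^ i) i / qpoch_nat q q i" for i
  define f where "f i = qpoch_nat q (q * s * inverse v) i * qpoch (v * inverse s) q (- int i)" for i
  have h_Suc: "h (Suc i) = - (inverse q ^ Suc i) * h i" for i
  proof -
    have "inverse q ^ Suc i * q = inverse q ^ i" using q0 by simp
    then have 1: "qpoch_nat q (inverse q ^ Suc i) (Suc i) = (1 - inverse q ^ Suc i) * qpoch_nat q (inverse q ^ i) i"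
      by (simp only: qpoch_nat_rec)
    have 2: "1 - inverse q ^ Suc i = - (inverse q ^ Suc i) * (1 - q * q ^ i)"
      using q0 by (simp add: power_inverse field_simps)
    have "1 - q * q ^ i \<noteq> 0" using q1[of "Suc i"] by simp
    then show ?thesis
      unfolding h_def 1 2 qpoch_nat_Suc[of q q] using qp_qq[of i] by simp
  qed
  have f_Suc: "f (Suc i) = - (s / v) * q ^ Suc i * f i" for i
  proof -
    have nz: "1 - q powi (- int (Suc i)) * (v * inverse s) \<noteq> 0" by (rule v_s) simp
    have "- int (Suc i) + 1 = - int i" by simp
    then have "qpoch (v * inverse s) q (- int i)
        = qpoch (v * inverse s) q (- int (Suc i)) * (1 - v * inverse s * q powi (- int (Suc i)))"
      using qpoch_add_1[of "- int (Suc i)" q "v * inverse s"] nz by metis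
    moreover have "1 - q * s * inverse v * q ^ i
        = - (s / v) * q ^ Suc i * (1 - v * inverse s * q powi (- int (Suc i)))"
      using q0 s0 v0 by (simp add: power_int_minus field_simps del: of_nat_Suc)
    ultimately show ?thesis by (simp add: f_def qpoch_nat_Suc)
  qed
  have key: "(-1) ^ i * q4 powi (2 * (int i)\<^sup>2 - 2 * int i) * s powi (- int i) * v ^ i * (q ^ i * h i * h i * f i) = 1" for i
  proof (induction i)
    case 0
    show ?case by (simp add: h_def f_def qpoch_def)
  next
    case (Suc i)
    have "2 * (int (Suc i))\<^sup>2 - 2 * int (Suc i) = (2 * (int i)\<^sup>2 - 2 * int i) + 4 * int i"
      by (simp add: power2_eq_square algebra_simps)
    then have e: "q4 powi (2 * (int (Suc i))\<^sup>2 - 2 * int (Suc i)) = q4 powi (2 * (int i)\<^sup>2 - 2 * int i) * q ^ i"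
      using q4_0 by (simp only: power_int_add q_power_q4 not_False_eq_True simp_thms)
    have sp: "s powi (- int (Suc i)) = s powi (- int i) / s"
      using s0 by (simp add: power_int_minus field_simps del: of_nat_Suc)
    have "(-1) ^ Suc i * q4 powi (2 * (int (Suc i))\<^sup>2 - 2 * int (Suc i)) * s powi (- int (Suc i)) * v ^ Suc i
        * (q ^ Suc i * h (Suc i) * h (Suc i) * f (Suc i))
      = ((-1) ^ i * q4 powi (2 * (int i)\<^sup>2 - 2 * int i) * s powi (- int i) * v ^ i * (q ^ i * h i * h i * f i))
        * ((q ^ i) * v / s * q * inverse q ^ Suc i * inverse q ^ Suc i * (s / v) * q ^ Suc i)"
      unfolding e sp h_Suc f_Suc by (simp add: field_simps)
    also have "(q ^ i) * v / s * q * inverse q ^ Suc i * inverse q ^ Suc i * (s / v) * q ^ Suc i = 1"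
      using q0 s0 v0 by (simp add: power_inverse field_simps)
    finally show ?case using Suc.IH by simp
  qed
  have "Phi q i (inverse q ^ i) (s * v) (q * s * inverse v) (s\<^sup>2) (q * inverse q ^ i) (q / q ^ i)
      = term4 q i (inverse q ^ i) (s * v) (q * s * inverse v) (s\<^sup>2) (q * inverse q ^ i) (q / q ^ i) i"
    unfolding Phi_def
  proof -
    let ?f = "term4 q i (inverse q ^ i) (s * v) (q * s * inverse v) (s\<^sup>2) (q * inverse q ^ i) (q / q ^ i)"
    have "(\<Sum>k\<le>i. ?f k) = (\<Sum>k\<in>{i}. ?f k)"
      by (rule sum.mono_neutral_right) (auto intro!: term4_eq_0)
    then show "(\<Sum>k\<le>i. ?f k) = ?f i" by simp
  qed
  moreover have "q powi (int 0 - int i) = inverse q ^ i"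
    by (simp add: power_int_minus power_inverse)
  ultimately have "Fw 0 i 0 i 0 = fused_prefactor i 0 i 0 * term4 q i (inverse q ^ i) (s * v) (q * s * inverse v) (s\<^sup>2) (q * inverse q ^ i) (q / q ^ i) i"
    using fused_weight_eq_Phi[of i 0 i 0 0] by simp
  also have "\<dots> = (-1) ^ i * q4 powi (2 * (int i)\<^sup>2 - 2 * int i) * s powi (- int i) * v ^ i * (q ^ i * h i * h i * f i)"
    using qp_vs[of i] by (simp add: fused_prefactor_def term4_def h_def f_def mult_ac)
  finally show ?thesis using key by simp
qed

text \<open>The one surviving term contains \<open>(q^(-i2);q)_i1\<close>, which vanishes for
  \<open>i2 < i1\<close>.\<close>

lemma fused_weight_0_eq_0:
  assumes "j2 > 0"
  shows "Fw 0 i1 0 i2 j2 = 0"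
proof (cases "i1 = i2 + j2")
  case True
  have "term4 q i1 (inverse q ^ i2) y e b d (q / q ^ i1) k = 0" if "k \<le> i1" for k y e b d
  proof (cases "k = i1")
    case True
    have "inverse q ^ i2 * q ^ i2 = 1" using q0 by (simp add: power_inverse)
    then have "qpoch_nat q (inverse q ^ i2) k = 0"
      using True \<open>i1 = i2 + j2\<close> assms by (auto simp: qpoch_nat_def intro!: bexI[of _ i2])
    then show ?thesis by (simp add: term4_def)
  next
    case False
    then show ?thesis using that by (intro term4_eq_0) simp
  qed
  then show ?thesis
    using fused_weight_eq_Phi[of i1 0 i2 j2 0] True by (simp add: Phi_def)
qed (simp add: fused_weight_def)

text \<open>Scanning from the left, each column receives no horizontal path and may emit none, so
  only weights with \<open>j1 = 0\<close> ever occur in a nonzero product.\<close>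

lemma row_sum_fused_weight_0: "row_sum (Fw 0) M N = (if M = N then 1 else 0)"
proof (cases "M = N")
  case True
  then show ?thesis by (simp add: row_sum_def dominates_refl flux_def fused_weight_0_eq_1)
next
  case False
  have "row_sum (Fw 0) M N = 0"
  proof (rule ccontr)
    assume nz: "row_sum (Fw 0) M N \<noteq> 0"
    then have dom: "dominates M N" by (auto simp: row_sum_def split: if_splits)
    obtain a b where M: "set_mset M \<subseteq> {a..b}" and N: "set_mset N \<subseteq> {a..b}"
      using mset_bounds by metis
    have fin: "finite {x. count M x + flux M N (x - 1) > 0}"
      by (rule finite_subset[OF row_support_subset[OF dom M N]]) simp
    have flux_ge: "flux M N x = 0" if "a - 1 \<le> x" for x
      using that
    proof (induction x rule: int_ge_induct)
      case base
      then show ?case by (intro flux_eq_0[OF dom M N]) simp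
    next
      case (step x)
      have cons: "count M (x + 1) + flux M N x = count N (x + 1) + flux M N (x + 1)"
        using flux_conserve[OF dom, of "x + 1"] by simp
      show ?case
      proof (cases "count M (x + 1) + flux M N x > 0")
        case True
        then have "Fw 0 (count M (x + 1)) (flux M N x) (count N (x + 1)) (flux M N (x + 1)) \<noteq> 0"
          using nz fin unfolding row_sum_def if_P[OF dom] prod_zero_iff[OF fin]
          by (metis (mono_tags, lifting) add_diff_cancel_right' mem_Collect_eq)
        then show ?thesis using fused_weight_0_eq_0 step.IH by (metis not_gr_zero)
      next
        case False
        then show ?thesis using cons by simp
      qed
    qed
    have "flux M N x = 0" for x
      using flux_ge[of x] flux_eq_0[OF dom M N, of x] by linarith
    then have "below M x = below N x" for x
      using dom by (simp add: flux_def dominates_def order_antisym)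
    then have "count M x = count N x" for x
      using below_rec[of M x] below_rec[of N x] by simp
    with False show False by (simp add: multiset_eq_iff)
  qed
  with False show ?thesis by simp
qed

section \<open>Induction on the number of rows\<close>

lemma fused_weight_unit: "Fw J 0 0 0 0 = 1"
  by (simp add: fused_weight_def phi_bar_def qpoch_def)

text \<open>The two recurrences are the hypothesis \<open>rec\<close> of
  \<open>row_sum_fusion\<close> for \<beta>' = 0 and \<beta>' = 1, cleared of the common denominator
  \<open>1 - s q^J v\<close> of the vertex weights.\<close>

lemma row_sum_fused_weight_Suc:
  "(\<Sum>K | dominates M K \<and> dominates K N.
      row_sum (Fw J) M K * row_sum (vertex_weight q s (q ^ J * v)) K N) = row_sum (Fw (Suc J)) M N"
proof (rule row_sum_fusion[where p = "\<lambda>\<beta> j. if \<beta> = 0 then split0 J j else split1 J j"])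
  let ?u = "q ^ J * v"
  have D: "1 - s * ?u \<noteq> 0" using vs[of J] by (simp add: mult_ac)
  show "vertex_weight q s ?u 0 0 0 0 = 1" using D by (simp add: vertex_weight_def)
  show "vertex_weight q s ?u i1 j1 i2 j2 = 0" if "j2 > 1" for i1 j1 i2 j2
    using that by (simp add: vertex_weight_def)
  show "(if (0::nat) = 0 then split0 J 0 else split1 J 0) \<noteq> 0"
    using q1[of "Suc J"] by (simp add: split0_def mult.commute)
  fix i1 j1 i2 j2 \<beta>' :: nat
  assume \<beta>': "\<beta>' \<le> 1" "\<beta>' \<le> j2" and cons: "i1 + j1 = i2 + j2"
  let ?S = "\<Sum>\<beta>\<in>{0, 1}. if \<beta> \<le> j1 \<and> \<beta> \<le> i2 + \<beta>'
      then (if \<beta> = 0 then split0 J j1 else split1 J j1)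
         * (Fw J i1 (j1 - \<beta>) (i2 + \<beta>' - \<beta>) (j2 - \<beta>') * vertex_weight q s ?u (i2 + \<beta>' - \<beta>) \<beta> i2 \<beta>') else 0"
  consider "\<beta>' = 0" | j where "\<beta>' = 1" "j2 = Suc j"
    using \<beta>' by (cases "\<beta>' = 0"; cases j2) auto
  then show "(if \<beta>' = 0 then split0 J j2 else split1 J j2) * Fw (Suc J) i1 j1 i2 j2 = ?S"
  proof cases
    case 1
    have "(1 - s * ?u) * (split0 J j2 * Fw (Suc J) i1 j1 i2 j2) = (1 - s * ?u) * ?S"
      using fused_weight_rec0[OF cons, of J] D 1
      by (simp add: vertex_weight_def mult_ac distrib_left)
    then show ?thesis using D 1 by simp
  next
    case 2
    have "(1 - s * ?u) * (split1 J j2 * Fw (Suc J) i1 j1 i2 j2) = (1 - s * ?u) * ?S"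
      using fused_weight_rec1[of i1 j1 i2 j J] cons D 2
      by (simp add: vertex_weight_def mult_ac distrib_left)
    then show ?thesis using D 2 by simp
  qed
qed (rule fused_weight_unit)+

lemma confs_sum_vertex_weight:
  "confs_sum (\<lambda>j. vertex_weight q s (q ^ nat (j - 1) * v)) J M N = row_sum (Fw J) M N"
proof (induction J arbitrary: N)
  case 0
  show ?case by (simp add: row_sum_fused_weight_0)
next
  case (Suc J)
  show ?case
    unfolding confs_sum_Suc Suc.IH by (simp add: row_sum_fused_weight_Suc)
qed

end

theorem corollary6p5:
  fixes q q4 s v :: complex and J :: nat
  assumes "q4 ^ 4 = q"
    and "q \<noteq> 0" and "\<And>n::nat. n \<ge> 1 \<Longrightarrow> q ^ n \<noteq> 1"
    and "s \<noteq> 0" and "v \<noteq> 0"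
    and "\<And>n::nat. 1 - q ^ n * (v * s) \<noteq> 0"
    and "\<And>n::nat. n \<ge> 1 \<Longrightarrow> 1 - q powi (- int n) * (v * inverse s) \<noteq> 0"
    and "J \<ge> 1"
  shows "corresponds (\<lambda>\<nu> \<mu>. G q s (map (\<lambda>r. q ^ r * v) [0..<J]) \<nu> \<mu>)
           (fused_weight q4 q s J v)"
  unfolding corresponds_def
proof (intro allI ballI)
  fix L \<nu> \<mu>
  let ?us = "map (\<lambda>r. q ^ r * v) [0..<J]"
  have "G q s ?us \<nu> \<mu> = confs_sum (\<lambda>j. vertex_weight q s (?us ! nat (j - 1))) J (mset \<mu>) (mset \<nu>)"
    by (simp add: G_def path_sum_eq_confs_sum)
  also have "\<dots> = confs_sum (\<lambda>j. vertex_weight q s (q ^ nat (j - 1) * v)) J (mset \<mu>) (mset \<nu>)"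
  proof (rule confs_sum_cong)
    fix j assume "j \<le> int J"
    \<comment> \<open>For \<open>j\<close> below 1 the index \<open>nat (j - 1)\<close> is 0, a
      valid position because \<open>J\<close> is at least 1.\<close>
    then have "nat (j - 1) < J" using assms(8) by linarith
    then show "vertex_weight q s (?us ! nat (j - 1)) = vertex_weight q s (q ^ nat (j - 1) * v)" by simp
  qed
  also have "\<dots> = row_sum (fused_weight q4 q s J v) (mset \<mu>) (mset \<nu>)"
    by (rule confs_sum_vertex_weight[OF assms(1-7)])
  also have "\<dots> = path_sum (\<lambda>_. fused_weight q4 q s J v) 1 \<nu> \<mu>"
    by (simp only: path_sum_eq_confs_sum confs_sum_1)
  finally show "G q s ?us \<nu> \<mu> = path_sum (\<lambda>_. fused_weight q4 q s J v) 1 \<nu> \<mu>" .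
qed

end
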